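(* Let $V$ be a vertex operator algebra, fix $n\in\mathbb{Z}_+$, and let $u\in V$ have weight $\mathrm{wt}\,u\ge -n$ such that $V^u=\langle u\rangle^1$ satisfies the permutation property and acts strongly on a subset $W\subset V$ consisting of homogeneous vectors. Then: (1) $A_n^u$ is generated by the elements $u_{-2n}^{i_{2n}}u_{-2n+1}^{i_{2n-1}}\cdots u_{-1}^{i_1}\mathbf{1}+O_n(V)$, $i_1,\dots,i_{2n}\in\mathbb{N}$, and every element of $A_n^u.W$ is a linear combination of elements $u_{-2n}^{i_{2n}}\cdots u_{-1}^{i_1}v_{-k}\mathbf{1}+O_n(V)$ with $v\in W$, $k\in\mathbb{Z}_+$, $i_j\in\mathbb{N}$. (2) For $v\in W$ and $k\in\mathbb{Z}_+$, \[ u_{-2n-1}v_{-k}\mathbf{1}\approx-\Big(\frac{\mathrm{wt}\,u+\mathrm{wt}\,v+2n+k-2}{2n}\Big)u_{-2n}v_{-k}\mathbf{1}-\frac{k}{2n}u_{-2n}v_{-k-1}\mathbf{1}. \] (3) For $v\in W$, $i_1,\dots,i_{2n}\in\mathbb{N}$ and $i_{2n+1},k\in\mathbb{Z}_+$, set $N=i_1+\cdots+i_{2n+1}$, $M=u_{-2n-1}^{i_{2n+1}-1}u_{-2n}^{i_{2n}+1}u_{-2n+1}^{i_{2n-1}}\cdots u_{-1}^{i_1}$, and for $1\le l\le 2n-1$ let $M^{(l)}$ be the monomial obtained from $M$ by raising the exponent of $u_{-l-1}$ by one and lowering the exponent of $u_{-l}$ by one. Let $D=\sum_{j=1}^{n+\mathrm{wt}\,u}\binom{n+\mathrm{wt}\,u}{j-1}u_{\mathrm{wt}\,u-n-j-1}$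 (so $D=0$ if $\mathrm{wt}\,u=-n$). Then \begin{multline*} u_{-2n-1}^{i_{2n+1}}u_{-2n}^{i_{2n}}\cdots u_{-1}^{i_1}v_{-k}\mathbf{1}\equiv_n-\frac{1}{2n(i_{2n}+1)}\Bigg(\Big(\mathrm{wt}(v_{-k}\mathbf{1})-1+\sum_{j=1}^{2n+1}i_j(\mathrm{wt}\,u+j-1)\Big)Mv_{-k}\mathbf{1}\\ -(2n+1)(i_{2n+1}-1)\,D\,u_{-2n-1}^{i_{2n+1}-2}u_{-2n}^{i_{2n}+1}u_{-2n+1}^{i_{2n-1}}\cdots u_{-1}^{i_1}v_{-k}\mathbf{1}+\sum_{l=1}^{2n-1}l\,i_l\,M^{(l)}v_{-k}\mathbf{1}+k\,Mv_{-k-1}\mathbf{1}+f\Bigg) \end{multline*} for some $f\in F_{N-1}(v_{-k}\mathbf{1})$ (the term containing $D$ is absent when $i_{2n+1}=1$, since its coefficient vanishes), and $f=0$ if the operators $u_{-j}$, $j\in\mathbb{Z}_+$, pairwise commute.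
   Context: $V$ has vacuum $\mathbf{1}$, modes $Y(v,x)=\sum v_kx^{-k-1}$, Virasoro operators $L(m)$, weights $\mathrm{wt}$ ($L(0)$-eigenvalues; $\mathrm{wt}(v_{-k}\mathbf{1})=\mathrm{wt}\,v+k-1$). For homogeneous $a$, $a\circ_nb=\mathrm{Res}_x(1+x)^{\mathrm{wt}\,a+n}Y(a,x)b\,x^{-2n-2}$; $O_n^\circ(V)=\mathrm{span}\{a\circ_nb\}$, $O^L(V)=\{(L(-1)+L(0))v\}$, $O_n(V)=O^L(V)+O_n^\circ(V)$, $A_n(V)=V/O_n(V)$ the level $n$ Zhu algebra with product $a*_nb=\sum_{m=0}^n(-1)^m\binom{m+n}{n}\mathrm{Res}_x(1+x)^{\mathrm{wt}\,a+n}Y(a,x)b\,x^{-n-m-1}$. $a\approx b$ means $a-b\in O^L(V)$; $a\equiv_nb$ means $a-b\in O_n(V)$. $V^u=\langle u\rangle^1$ is the span of all $u_{-k_1}\cdots u_{-k_r}\mathbf{1}$ ($k_i\in\mathbb{Z}_+$), assumed a vertex subalgebra. $F_r(w)$ is the span of $u_{-k_1}\cdots u_{-k_p}w$ with $p\le r$, $k_i\ge1$. Permutation property on $W$: for all $m\in\mathbb{Z}_+$, permutations $\sigma$, $u^{(i)}\in V^u$, $w\in W$, $k_i\in\mathbb{Z}$: $u^{(1)}_{-k_1}\cdots u^{(m)}_{-k_m}w-u^{(\sigma(1))}_{-k_{\sigma(1)}}\cdots u^{(\sigma(m))}_{-k_{\sigma(m)}}w\in F_{m-1}(w)$; "satisfies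 the permutation property" means this for $W=V^u$. Acting strongly on $W$: permutation property on $W$ and $a_jw=0$ for all $a\in V^u$, $w\in W$, $j\ge0$. $A_n^u$ is the subalgebra of $A_n(V)$ generated by $V^u+O_n(V)$; $A_n^u.W$ is the set of $u_{-k_1}\cdots u_{-k_m}v+O_n(V)$, $v\in W$, $k_i\in\mathbb{Z}_+$. Binomials $\binom{p}{q}=p(p-1)\cdots(p-q+1)/q!$ for $q\in\mathbb{N}$. *)

theory Defs
  imports Complex_Main "HOL-Library.Multiset"
begin

text \<open>Data of a VOA: scalar multiplication, modes (Y a n b = a_n b), vacuum, conformal
  vector and central charge.\<close>

record 'v voa =
  scl :: "complex \<Rightarrow> 'v \<Rightarrow> 'v"
  md  :: "'v \<Rightarrow> int \<Rightarrow> 'v \<Rightarrow> 'v"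
  vac :: "'v"
  cvec :: "'v"
  cch :: complex

definition fsum :: "(nat \<Rightarrow> 'v::comm_monoid_add) \<Rightarrow> 'v" where
  "fsum f = sum f {i. f i \<noteq> 0}"

definition spn :: "('v::ab_group_add, 'b) voa_scheme \<Rightarrow> 'v set \<Rightarrow> 'v set" where
  "spn V S = module.span (scl V) S"

definition Lop :: "('v, 'b) voa_scheme \<Rightarrow> int \<Rightarrow> 'v \<Rightarrow> 'v" where
  "Lop V m = md V (cvec V) (m + 1)"

definition eigsp :: "('v, 'b) voa_scheme \<Rightarrow> int \<Rightarrow> 'v set" where
  "eigsp V m = {v. Lop V 0 v = scl V (of_int m) v}"

definition sgn_pow :: "int \<Rightarrow> complex" where
  "sgn_pow r = (if even r then 1 else -1)"

definition borcherds :: "('v::ab_group_add, 'b) voa_scheme \<Rightarrow> bool" where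
  "borcherds V \<longleftrightarrow> (\<forall>a b c p q r.
     fsum (\<lambda>i. scl V (of_int p gchoose i) (md V (md V a (r + int i) b) (p + q - int i) c))
   = fsum (\<lambda>i. scl V ((-1)^i * (of_int r gchoose i)) (md V a (p + r - int i) (md V b (q + int i) c)))
   - scl V (sgn_pow r)
       (fsum (\<lambda>i. scl V ((-1)^i * (of_int r gchoose i)) (md V b (q + r - int i) (md V a (p + int i) c)))))"

definition is_VOA :: "('v::ab_group_add, 'b) voa_scheme \<Rightarrow> bool" where
  "is_VOA V \<longleftrightarrow>
     vector_space (scl V) \<and>
     (\<forall>a b n w. md V (a + b) n w = md V a n w + md V b n w) \<and>
     (\<forall>s a n w. md V (scl V s a) n w = scl V s (md V a n w)) \<and>
     (\<forall>a n w1 w2. md V a n (w1 + w2) = md V a n w1 + md V a n w2) \<and>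
     (\<forall>a n s w. md V a n (scl V s w) = scl V s (md V a n w)) \<and>
     (\<forall>a b. \<exists>N. \<forall>n\<ge>N. md V a n b = 0) \<and>
     (\<forall>n w. md V (vac V) n w = (if n = -1 then w else 0)) \<and>
     (\<forall>a. md V a (-1) (vac V) = a \<and> (\<forall>n\<ge>0. md V a n (vac V) = 0)) \<and>
     borcherds V \<and>
     (\<forall>m n w. Lop V m (Lop V n w) - Lop V n (Lop V m w)
        = scl V (of_int (m - n)) (Lop V (m + n) w)
          + (if m + n = 0 then scl V ((of_int m ^ 3 - of_int m) / 12 * cch V) w else 0)) \<and>
     (\<forall>a n w. md V (Lop V (-1) a) n w = scl V (- of_int n) (md V a (n - 1) w)) \<and>
     (\<forall>v. v \<in> spn V (\<Union>m. eigsp V m)) \<and>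
     (\<forall>m. \<exists>B. finite B \<and> eigsp V m \<subseteq> spn V B) \<and>
     (\<exists>m0. \<forall>m<m0. eigsp V m = {0})"

definition hom :: "('v, 'b) voa_scheme \<Rightarrow> 'v \<Rightarrow> bool" where
  "hom V v \<longleftrightarrow> (\<exists>m. v \<in> eigsp V m)"

text \<open>Weight of a homogeneous vector (determined uniquely when v is nonzero).\<close>
definition wt :: "('v, 'b) voa_scheme \<Rightarrow> 'v \<Rightarrow> int" where
  "wt V v = (THE m. v \<in> eigsp V m)"

definition hcomp :: "('v::ab_group_add, 'b) voa_scheme \<Rightarrow> int \<Rightarrow> 'v \<Rightarrow> 'v" where
  "hcomp V m a = (THE w. w \<in> eigsp V m \<and> a - w \<in> spn V (\<Union>m'\<in>-{m}. eigsp V m'))"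

text \<open>a o_n b = Res_x (1+x)^(wt a + n) Y(a,x) b x^(-2n-2), a homogeneous.\<close>
definition circ :: "('v::ab_group_add, 'b) voa_scheme \<Rightarrow> nat \<Rightarrow> 'v \<Rightarrow> 'v \<Rightarrow> 'v" where
  "circ V n a b = fsum (\<lambda>i. scl V (of_int (wt V a + int n) gchoose i)
                              (md V a (int i - 2 * int n - 2) b))"

definition Ocirc :: "('v::ab_group_add, 'b) voa_scheme \<Rightarrow> nat \<Rightarrow> 'v set" where
  "Ocirc V n = spn V {circ V n a b | a b. hom V a}"

definition OL :: "('v::ab_group_add, 'b) voa_scheme \<Rightarrow> 'v set" where
  "OL V = {Lop V (-1) v + Lop V 0 v | v. True}"

definition On :: "('v::ab_group_add, 'b) voa_scheme \<Rightarrow> nat \<Rightarrow> 'v set" where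
  "On V n = spn V (OL V \<union> Ocirc V n)"

definition star_h :: "('v::ab_group_add, 'b) voa_scheme \<Rightarrow> nat \<Rightarrow> 'v \<Rightarrow> 'v \<Rightarrow> 'v" where
  "star_h V n a b = (\<Sum>m = 0..n. scl V ((-1)^m * of_nat ((m + n) choose n))
      (fsum (\<lambda>i. scl V (of_int (wt V a + int n) gchoose i)
                   (md V a (int i - int n - int m - 1) b))))"

definition star :: "('v::ab_group_add, 'b) voa_scheme \<Rightarrow> nat \<Rightarrow> 'v \<Rightarrow> 'v \<Rightarrow> 'v" where
  "star V n a b = (\<Sum>m\<in>{m. hcomp V m a \<noteq> 0}. star_h V n (hcomp V m a) b)"

definition approx :: "('v::ab_group_add, 'b) voa_scheme \<Rightarrow> 'v \<Rightarrow> 'v \<Rightarrow> bool" where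
  "approx V a b \<longleftrightarrow> a - b \<in> OL V"

definition equivn :: "('v::ab_group_add, 'b) voa_scheme \<Rightarrow> nat \<Rightarrow> 'v \<Rightarrow> 'v \<Rightarrow> bool" where
  "equivn V n a b \<longleftrightarrow> a - b \<in> On V n"

definition applyl :: "('v, 'b) voa_scheme \<Rightarrow> ('v \<times> int) list \<Rightarrow> 'v \<Rightarrow> 'v" where
  "applyl V xs w = foldr (\<lambda>(a, k) x. md V a (- k) x) xs w"

definition umon :: "('v, 'b) voa_scheme \<Rightarrow> 'v \<Rightarrow> nat list \<Rightarrow> 'v \<Rightarrow> 'v" where
  "umon V u ks w = applyl V (map (\<lambda>k. (u, int k)) ks) w"

definition Vu :: "('v::ab_group_add, 'b) voa_scheme \<Rightarrow> 'v \<Rightarrow> 'v set" where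
  "Vu V u = spn V {umon V u ks (vac V) | ks. \<forall>k\<in>set ks. k \<ge> 1}"

definition Fsp :: "('v::ab_group_add, 'b) voa_scheme \<Rightarrow> 'v \<Rightarrow> nat \<Rightarrow> 'v \<Rightarrow> 'v set" where
  "Fsp V u r w = spn V {umon V u ks w | ks. length ks \<le> r \<and> (\<forall>k\<in>set ks. k \<ge> 1)}"

definition vertex_subalg :: "('v::ab_group_add, 'b) voa_scheme \<Rightarrow> 'v set \<Rightarrow> bool" where
  "vertex_subalg V S \<longleftrightarrow> module.subspace (scl V) S \<and> vac V \<in> S \<and>
     (\<forall>a\<in>S. \<forall>b\<in>S. \<forall>j. md V a j b \<in> S)"

definition perm_prop :: "('v::ab_group_add, 'b) voa_scheme \<Rightarrow> 'v \<Rightarrow> 'v set \<Rightarrow> bool" where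
  "perm_prop V u W \<longleftrightarrow> (\<forall>xs ys w. xs \<noteq> [] \<and> mset ys = mset xs \<and>
      set (map fst xs) \<subseteq> Vu V u \<and> w \<in> W \<longrightarrow>
      applyl V xs w - applyl V ys w \<in> Fsp V u (length xs - 1) w)"

definition acts_strongly :: "('v::ab_group_add, 'b) voa_scheme \<Rightarrow> 'v \<Rightarrow> 'v set \<Rightarrow> bool" where
  "acts_strongly V u W \<longleftrightarrow> perm_prop V u W \<and>
      (\<forall>a\<in>Vu V u. \<forall>w\<in>W. \<forall>j\<ge>0. md V a j w = 0)"

text \<open>A_n^u, as the set of representatives: the smallest subspace containing V^u + O_n(V)
  closed under *_n.\<close>
definition Anu :: "('v::ab_group_add, 'b) voa_scheme \<Rightarrow> nat \<Rightarrow> 'v \<Rightarrow> 'v set" where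
  "Anu V n u = \<Inter>{S. module.subspace (scl V) S \<and> Vu V u \<subseteq> S \<and> On V n \<subseteq> S \<and>
                     (\<forall>a\<in>S. \<forall>b\<in>S. star V n a b \<in> S)}"

fun uops :: "('v, 'b) voa_scheme \<Rightarrow> 'v \<Rightarrow> (nat \<Rightarrow> nat) \<Rightarrow> nat \<Rightarrow> 'v \<Rightarrow> 'v" where
  "uops V u i 0 w = w"
| "uops V u i (Suc j) w = (md V u (- int (Suc j)) ^^ i (Suc j)) (uops V u i j w)"

end

theory Submission
  imports Defs "HOL-Computational_Algebra.Formal_Power_Series"
begin

text \<open>
  Write \<open>R p q a b = Res\<^sub>x (1+x)^p x^{-q} Y(a,x)b\<close>. Integrating the Borcherds identity against
  \<open>(1+z\<^sub>1)^A z\<^sub>1^p (1+z\<^sub>2)^B z\<^sub>2^q (z\<^sub>1-z\<^sub>2)^r\<close> shows that \<open>O\<^sub>n(V)\<close> is a two-sided ideal for \<open>*\<^sub>n\<close>, so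
  \<open>V^u + O\<^sub>n(V)\<close> is closed under \<open>*\<^sub>n\<close>. As \<open>a_j v = 0\<close> for \<open>a \<in> V^u\<close> and \<open>j \<ge> 0\<close>, the modes of \<open>u\<close> commute
  with those of \<open>v\<close>, and the permutation property on the vacuum transfers to \<open>v_{-k} 1\<close>. The relation
  (3) is \<open>(L(-1) + L(0)) M v_{-k} 1 \<in> O\<^sub>n(V)\<close> with \<open>L(-1)\<close> moved to the right, the factors reordered and
  the mode \<open>u_{-2n-2}\<close> eliminated by \<open>u \<circ>\<^sub>n _\<close>. The spanning statements follow by induction on the
  number of modes, the sum of the modes and the number of factors \<open>u_{-2n-1}\<close>, ordered lexicographically.
\<close>

text \<open>The product \<open>star\<close> enters only in the first half of (1): \<open>Anu\<close>
  is the least subspace closed under it, so a spanning set must absorb products, and the two-sided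
  ideal property reduces these to products inside \<open>Vu V u\<close>. That half is then the
  spanning statement for \<open>v\<close> equal to the vacuum, where \<open>v_{-k} 1\<close> is the
  vacuum for \<open>k = 1\<close> and zero for larger \<open>k\<close>. The number 2n marks the
  reach of circle products: their pole order is 2n+2, so they eliminate \<open>u_{-2n-2}\<close> and
  everything below in favour of higher modes, but not \<open>u_{-2n-1}\<close>. That mode is reached
  by \<open>(L(-1) + L(0)) x\<close>, where a factor \<open>u_{-2n}\<close> gets raised; the
  original monomial then appears with a positive multiple of 2n as coefficient, and n >= 1 allows
  division. \<open>L(-1)\<close> also turns \<open>v_{-k} 1\<close> into a multiple of
  \<open>v_{-k-1} 1\<close>. The permutation property on \<open>W\<close> speaks of
  \<open>v = v_{-1} 1\<close> but not of these vectors, which is why it is carried over from the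
  vacuum. The assumption wt u >= -n makes \<open>(1+x)^(wt u + n)\<close> a polynomial, hence the
  finite sum \<open>D\<close>.\<close>

lemma fsum_eq_sum:
  assumes "\<And>i. i \<ge> K \<Longrightarrow> f i = 0"
  shows "fsum f = sum f {..<K}"
  unfolding fsum_def
proof (rule sum.mono_neutral_left)
  show "{i. f i \<noteq> 0} \<subseteq> {..<K}"
    using assms by (metis (mono_tags) lessThan_iff mem_Collect_eq not_le subsetI)
qed auto

lemma fsum_zero [simp]: "fsum (\<lambda>i. 0) = 0"
  by (simp add: fsum_def)

text \<open>Separates the summation index \<open>i\<close> from \<open>p\<close>; the factor
  \<open>of_nat i gchoose h\<close> can then be absorbed into the power of \<open>1+z\<close> by
  \<open>gbinomial_shift\<close>.\<close>

lemma gbinomial_int_Vandermonde: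
  "(of_int (p + int i) gchoose l :: complex)
     = (\<Sum>h\<le>l. (of_nat i gchoose h) * (of_int p gchoose (l - h)))"
  using gbinomial_Vandermonde[of "of_nat i :: complex" "of_int p" l] by (simp add: add.commute atLeast0AtMost)

lemma gbinomial_mult_choose:
  "(a gchoose i) * (of_nat i gchoose h) =
     (if h \<le> i then (a gchoose h) * (a - of_nat h gchoose (i - h)) else (0::complex))"
  using gbinomial_trinomial_revision[of h i a]
  by (auto simp flip: binomial_gbinomial)

section \<open>The axioms in mode form: commutators with \<open>L(-1)\<close> and
  \<open>L(0)\<close>, weights\<close>

locale vertex_operator_algebra =
  fixes V :: "('v::ab_group_add) voa"
  assumes VOA: "is_VOA V"
begin

sublocale vs: vector_space "scl V"
  using VOA by (simp add: is_VOA_def)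

abbreviation sc where "sc \<equiv> scl V"
abbreviation Y where "Y \<equiv> md V"
abbreviation vc where "vc \<equiv> vac V"
abbreviation L where "L \<equiv> Lop V"

lemma spn_eq [simp]: "spn V = vs.span"
  by (simp add: spn_def fun_eq_iff)

lemma Y_add_left: "Y (a + b) k w = Y a k w + Y b k w"
  and Y_scl_left: "Y (sc s a) k w = sc s (Y a k w)"
  and Y_add_right: "Y a k (w + w') = Y a k w + Y a k w'"
  and Y_scl_right: "Y a k (sc s w) = sc s (Y a k w)"
  and Y_vac_left: "Y vc k w = (if k = -1 then w else 0)"
  and Y_vac_right: "Y a (-1) vc = a" "k \<ge> 0 \<Longrightarrow> Y a k vc = 0"
  and Y_deriv: "Y (L (-1) a) k w = sc (- of_int k) (Y a (k - 1) w)"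
  and span_eigsp: "v \<in> vs.span (\<Union>m. eigsp V m)"
  using VOA by (simp_all add: is_VOA_def)

lemma borch:
  "fsum (\<lambda>i. sc (of_int p gchoose i) (Y (Y a (r + int i) b) (p + q - int i) c))
   = fsum (\<lambda>i. sc ((-1)^i * (of_int r gchoose i)) (Y a (p + r - int i) (Y b (q + int i) c)))
   - sc (sgn_pow r) (fsum (\<lambda>i. sc ((-1)^i * (of_int r gchoose i)) (Y b (q + r - int i) (Y a (p + int i) c))))"
  using VOA by (simp add: is_VOA_def borcherds_def)

lemma Y_trunc_int: "\<exists>K. \<forall>k\<ge>K. Y a k b = 0"
  using VOA by (simp add: is_VOA_def)

lemma Y_trunc: "\<exists>K::nat. \<forall>k\<ge>int K. Y a k b = 0"
proof -
  obtain K where "\<forall>k\<ge>K. Y a k b = 0"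
    using Y_trunc_int by blast
  hence "\<forall>k\<ge>int (nat K). Y a k b = 0" by auto
  thus ?thesis by blast
qed

lemma Y_0_left [simp]: "Y 0 k w = 0"
  using Y_scl_left[of 0 0 k w] by simp
lemma Y_0_right [simp]: "Y a k 0 = 0"
  using Y_scl_right[of a k 0 0] by simp
lemma Y_minus_left: "Y (- a) k w = - Y a k w"
  using Y_scl_left[of "-1" a k w] by simp
lemma Y_minus_right: "Y a k (- w) = - Y a k w"
  using Y_scl_right[of a k "-1" w] by simp
lemma Y_diff_right: "Y a k (w - w') = Y a k w - Y a k w'"
  using Y_add_right[of a k w "-w'"] by (simp add: Y_minus_right)
lemma Y_sum_right: "Y a k (sum f A) = (\<Sum>i\<in>A. Y a k (f i))"
  by (induction A rule: infinite_finite_induct) (simp_all add: Y_add_right)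

lemma L_add: "L k (a + b) = L k a + L k b"
  and L_scl: "L k (sc s a) = sc s (L k a)"
  and L_0 [simp]: "L k 0 = 0"
  and L_sum: "L k (sum f A) = (\<Sum>i\<in>A. L k (f i))"
  by (simp_all add: Lop_def Y_add_right Y_scl_right Y_sum_right)

lemma fsum_in:
  assumes "vs.subspace S" "\<And>i. f i \<in> S"
  shows "fsum f \<in> S"
  unfolding fsum_def by (rule vs.subspace_sum) (use assms in auto)

text \<open>Setting \<open>r = 0\<close> in the Borcherds identity leaves only the term
  \<open>i = 0\<close> of both sums on its right-hand side.\<close>

lemma commutator:
  "Y a p (Y b q c) - Y b q (Y a p c) = fsum (\<lambda>i. sc (of_int p gchoose i) (Y (Y a (int i) b) (p + q - int i) c))"
proof -
  have *: "fsum (\<lambda>i. sc ((-1)^i * (of_int 0 gchoose i)) (f i)) = f 0" for f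
    by (subst fsum_eq_sum[of 1]) (auto simp: gbinomial_0_left)
  show ?thesis
    using borch[of p a 0 b q c] by (simp only: *) (simp add: sgn_pow_def)
qed

text \<open>\<open>L 0\<close> is mode 1 of the conformal vector, so the commutator stops after
  \<open>i = 0, 1\<close>: it is \<open>(L(-1) a)_(k+1) + (L(0) a)_k\<close>, and the derivative
  axiom turns the first term into \<open>-(k+1) a_k\<close>.\<close>

lemma L0_comm:
  assumes "a \<in> eigsp V m"
  shows "L 0 (Y a k w) = Y a k (L 0 w) + sc (of_int (m - k - 1)) (Y a k w)"
proof -
  have g1: "(1 gchoose i :: complex) = 0" if "i \<ge> 2" for i
    using that binomial_gbinomial[of 1 i, where ?'a=complex] by (simp add: binomial_eq_0)
  have "L 0 (Y a k w) - Y a k (L 0 w) =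
     fsum (\<lambda>i. sc (of_int 1 gchoose i) (Y (Y (cvec V) (int i) a) (1 + k - int i) w))"
    by (simp add: Lop_def commutator del: of_int_1)
  also have "\<dots> = sum (\<lambda>i. sc (of_int 1 gchoose i) (Y (Y (cvec V) (int i) a) (1 + k - int i) w)) {..<2}"
    by (rule fsum_eq_sum) (simp add: g1)
  also have "\<dots> = Y (L (-1) a) (k + 1) w + Y (L 0 a) k w"
    by (simp add: numeral_2_eq_2 Lop_def add.commute)
  also have "\<dots> = sc (of_int (m - k - 1)) (Y a k w)"
    using assms by (simp add: Y_deriv eigsp_def Y_scl_left vs.scale_left_diff_distrib vs.scale_left_distrib)
  finally show ?thesis by (simp add: algebra_simps)
qed

lemma Lm1_comm: "L (-1) (Y a k w) = Y a k (L (-1) w) - sc (of_int k) (Y a (k - 1) w)"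
proof -
  have "L (-1) (Y a k w) - Y a k (L (-1) w) =
     fsum (\<lambda>i. sc (of_int 0 gchoose i) (Y (Y (cvec V) (int i) a) (0 + k - int i) w))"
    by (simp add: Lop_def commutator del: of_int_0)
  also have "\<dots> = sum (\<lambda>i. sc (of_int 0 gchoose i) (Y (Y (cvec V) (int i) a) (0 + k - int i) w)) {..<1}"
    by (rule fsum_eq_sum) (simp add: gbinomial_0_left)
  also have "\<dots> = Y (L (-1) a) k w"
    by (simp add: Lop_def)
  also have "\<dots> = - sc (of_int k) (Y a (k - 1) w)"
    by (simp add: Y_deriv)
  finally show ?thesis by (simp add: algebra_simps)
qed

lemma subspace_eigsp: "vs.subspace (eigsp V m)"
  by (rule vs.subspaceI) (auto simp: eigsp_def L_add L_scl vs.scale_right_distrib mult.commute)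

lemma eigsp_Y:
  assumes "a \<in> eigsp V m" "b \<in> eigsp V m'"
  shows "Y a k b \<in> eigsp V (m + m' - k - 1)"
  using L0_comm[OF assms(1), of k b] assms(2)
  by (simp add: eigsp_def Y_scl_right algebra_simps flip: vs.scale_left_distrib)

lemma L_vac: "L (-1) vc = 0" "L 0 vc = 0"
  by (simp_all add: Lop_def Y_vac_right)

lemma vac_eigsp: "vc \<in> eigsp V 0"
  by (simp add: eigsp_def L_vac)

text \<open>\<open>L(-1) a = a_{-2} 1\<close>, so this is an instance of the weight formula for
  modes.\<close>

lemma eigsp_Lm1:
  assumes "a \<in> eigsp V m"
  shows "L (-1) a \<in> eigsp V (m + 1)"
proof -
  have "L (-1) a = L (-1) (Y a (-1) vc)" by (simp add: Y_vac_right)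
  also have "\<dots> = Y a (-2) vc" unfolding Lm1_comm by (simp add: L_vac)
  also have "\<dots> \<in> eigsp V (m + 0 - (-2) - 1)" by (rule eigsp_Y[OF assms vac_eigsp])
  finally show ?thesis by (simp add: algebra_simps)
qed

lemma eigsp_inj:
  assumes "a \<in> eigsp V m" "a \<in> eigsp V m'" "a \<noteq> 0"
  shows "m = m'"
proof -
  have "sc (of_int m') a = sc (of_int m) a"
    using assms by (simp add: eigsp_def)
  thus ?thesis using assms(3) by simp
qed

lemma eigsp_wt: "hom V a \<Longrightarrow> a \<in> eigsp V (wt V a)"
proof (cases "a = 0")
  case False
  assume "hom V a"
  then obtain m where m: "a \<in> eigsp V m" by (auto simp: hom_def)
  show ?thesis unfolding wt_def
    by (rule theI[where P = "\<lambda>m. a \<in> eigsp V m", OF m]) (use eigsp_inj m False in blast)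
qed (simp add: vs.subspace_0[OF subspace_eigsp])

lemma wt_eq: "a \<in> eigsp V m \<Longrightarrow> a \<noteq> 0 \<Longrightarrow> wt V a = m"
  using eigsp_inj eigsp_wt by (metis hom_def)

lemma eigsp_homI: "a \<in> eigsp V m \<Longrightarrow> hom V a"
  by (auto simp: hom_def)

section \<open>Calculus of the one-variable residues \<open>R\<close>\<close>

definition R :: "int \<Rightarrow> int \<Rightarrow> 'v \<Rightarrow> 'v \<Rightarrow> 'v" where
  "R p q a b = fsum (\<lambda>i. sc (of_int p gchoose i) (Y a (int i - q) b))"

lemma R_eq_sum:
  assumes "\<And>i. i \<ge> K \<Longrightarrow> Y a (int i - q) b = 0"
  shows "R p q a b = (\<Sum>i<K. sc (of_int p gchoose i) (Y a (int i - q) b))"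
  unfolding R_def by (rule fsum_eq_sum) (simp add: assms)

lemma Y_bound: "\<exists>K. \<forall>i\<ge>K. Y a (int i - q) b = 0"
proof -
  obtain K where K: "\<forall>k\<ge>int K. Y a k b = 0" using Y_trunc by blast
  have "Y a (int i - q) b = 0" if "i \<ge> K + nat q" for i
    using K that by auto
  thus ?thesis by blast
qed

lemma R_zero [simp]: "R p q 0 b = 0" "R p q a 0 = 0"
  by (simp_all add: R_def)

lemma R_add_left: "R p q (a + a') b = R p q a b + R p q a' b"
proof -
  obtain K K' where *: "\<forall>i\<ge>K. Y a (int i - q) b = 0" "\<forall>i\<ge>K'. Y a' (int i - q) b = 0"
    using Y_bound by metis
  have "R p q (a + a') b = (\<Sum>i<max K K'. sc (of_int p gchoose i) (Y (a + a') (int i - q) b))"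
    by (rule R_eq_sum) (simp add: * Y_add_left)
  moreover have "R p q a b = (\<Sum>i<max K K'. sc (of_int p gchoose i) (Y a (int i - q) b))"
    by (rule R_eq_sum) (simp add: *)
  moreover have "R p q a' b = (\<Sum>i<max K K'. sc (of_int p gchoose i) (Y a' (int i - q) b))"
    by (rule R_eq_sum) (simp add: *)
  ultimately show ?thesis
    by (simp add: Y_add_left vs.scale_right_distrib sum.distrib)
qed

lemma R_add_right: "R p q a (b + b') = R p q a b + R p q a b'"
proof -
  obtain K K' where *: "\<forall>i\<ge>K. Y a (int i - q) b = 0" "\<forall>i\<ge>K'. Y a (int i - q) b' = 0"
    using Y_bound by metis
  have "R p q a (b + b') = (\<Sum>i<max K K'. sc (of_int p gchoose i) (Y a (int i - q) (b + b')))"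
    by (rule R_eq_sum) (simp add: * Y_add_right)
  moreover have "R p q a b = (\<Sum>i<max K K'. sc (of_int p gchoose i) (Y a (int i - q) b))"
    by (rule R_eq_sum) (simp add: *)
  moreover have "R p q a b' = (\<Sum>i<max K K'. sc (of_int p gchoose i) (Y a (int i - q) b'))"
    by (rule R_eq_sum) (simp add: *)
  ultimately show ?thesis
    by (simp add: Y_add_right vs.scale_right_distrib sum.distrib)
qed

lemma R_scl: "R p q (sc s a) b = sc s (R p q a b)" "R p q a (sc s b) = sc s (R p q a b)"
proof -
  obtain K where *: "\<forall>i\<ge>K. Y a (int i - q) b = 0" using Y_bound by metis
  have **: "R p q a b = (\<Sum>i<K. sc (of_int p gchoose i) (Y a (int i - q) b))"
    by (rule R_eq_sum) (simp add: *)
  show "R p q (sc s a) b = sc s (R p q a b)"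
    unfolding ** by (subst R_eq_sum[of K]) (simp_all add: * Y_scl_left vs.scale_sum_right mult.commute)
  show "R p q a (sc s b) = sc s (R p q a b)"
    unfolding ** by (subst R_eq_sum[of K]) (simp_all add: * Y_scl_right vs.scale_sum_right mult.commute)
qed

lemma R_sum_right: "R p q a (sum f A) = (\<Sum>i\<in>A. R p q a (f i))"
  by (induction A rule: infinite_finite_induct) (simp_all add: R_add_right)

text \<open>\<open>(1+x)^(p+1) = (1+x)^p + x (1+x)^p\<close>, and the factor \<open>x\<close> lowers
  the pole order by one.\<close>

lemma R_pascal: "R (p + 1) q a b = R p q a b + R p (q - 1) a b"
proof -
  obtain K1 K2 where *: "\<forall>i\<ge>K1. Y a (int i - q) b = 0" "\<forall>i\<ge>K2. Y a (int i - (q - 1)) b = 0"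
    using Y_bound by metis
  define K where "K = max K1 K2"
  have K: "\<forall>i\<ge>K. Y a (int i - q) b = 0" "\<forall>i\<ge>K. Y a (int i - (q - 1)) b = 0"
    using * by (auto simp: K_def)
  have "R (p + 1) q a b = (\<Sum>i<Suc K. sc (of_int (p+1) gchoose i) (Y a (int i - q) b))"
    by (rule R_eq_sum) (simp add: K)
  also have "\<dots> = Y a (- q) b + (\<Sum>i<K. sc (of_int (p+1) gchoose (Suc i)) (Y a (int (Suc i) - q) b))"
    by (subst sum.lessThan_Suc_shift) simp
  also have "(\<Sum>i<K. sc (of_int (p+1) gchoose (Suc i)) (Y a (int (Suc i) - q) b))
     = (\<Sum>i<K. sc (of_int p gchoose (Suc i)) (Y a (int (Suc i) - q) b))
       + (\<Sum>i<K. sc (of_int p gchoose i) (Y a (int i - (q - 1)) b))"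
    unfolding of_int_add of_int_1 gbinomial_Suc_Suc vs.scale_left_distrib sum.distrib by (simp add: algebra_simps)
  also have "(\<Sum>i<K. sc (of_int p gchoose i) (Y a (int i - (q - 1)) b)) = R p (q - 1) a b"
    by (rule R_eq_sum[symmetric]) (use K in auto)
  also have "Y a (- q) b + ((\<Sum>i<K. sc (of_int p gchoose (Suc i)) (Y a (int (Suc i) - q) b)) + R p (q - 1) a b)
     = (\<Sum>i<Suc K. sc (of_int p gchoose i) (Y a (int i - q) b)) + R p (q - 1) a b"
    by (subst sum.lessThan_Suc_shift) simp
  also have "(\<Sum>i<Suc K. sc (of_int p gchoose i) (Y a (int i - q) b)) = R p q a b"
    by (rule R_eq_sum[symmetric]) (use K in auto)
  finally show ?thesis .
qed

text \<open>Integration by parts: the residue of the derivative of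
  \<open>(1+x)^(p+1) x^(-q) Y(a,x) b\<close> vanishes, and \<open>Y(L(-1) a, x)\<close> is the
  derivative of \<open>Y(a,x)\<close>.\<close>

lemma R_deriv:
  "R (p + 1) q (L (-1) a) b = sc (of_int q) (R (p + 1) (q + 1) a b) - sc (of_int (p + 1)) (R p q a b)"
proof -
  obtain K1 K2 where *: "\<forall>i\<ge>K1. Y a (int i - q) b = 0" "\<forall>i\<ge>K2. Y a (int i - (q + 1)) b = 0"
    using Y_bound by metis
  define K where "K = max K1 K2"
  have K: "\<forall>i\<ge>K. Y a (int i - q) b = 0" "\<forall>i\<ge>K. Y a (int i - (q + 1)) b = 0"
    using * by (auto simp: K_def)
  have "R (p + 1) q (L (-1) a) b = (\<Sum>i<Suc K. sc (of_int (p+1) gchoose i) (Y (L (-1) a) (int i - q) b))"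
    by (rule R_eq_sum) (use K in \<open>simp add: Y_deriv algebra_simps\<close>)
  also have "\<dots> = (\<Sum>i<Suc K. sc (of_int q) (sc (of_int (p+1) gchoose i) (Y a (int i - (q + 1)) b))
       - sc (of_nat i * (of_int (p+1) gchoose i)) (Y a (int i - (q + 1)) b))"
    by (rule sum.cong) (simp_all add: Y_deriv algebra_simps vs.scale_left_diff_distrib)
  also have "\<dots> = sc (of_int q) (\<Sum>i<Suc K. sc (of_int (p+1) gchoose i) (Y a (int i - (q + 1)) b))
     - (\<Sum>i<Suc K. sc (of_nat i * (of_int (p+1) gchoose i)) (Y a (int i - (q + 1)) b))"
    unfolding sum_subtractf vs.scale_sum_right ..
  also have "(\<Sum>i<Suc K. sc (of_int (p+1) gchoose i) (Y a (int i - (q + 1)) b)) = R (p + 1) (q + 1) a b"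
    by (rule R_eq_sum[symmetric]) (use K in auto)
  also have "(\<Sum>i<Suc K. sc (of_nat i * (of_int (p+1) gchoose i)) (Y a (int i - (q + 1)) b))
     = (\<Sum>i<K. sc (of_nat (Suc i) * (of_int (p+1) gchoose (Suc i))) (Y a (int (Suc i) - (q + 1)) b))"
    by (subst sum.lessThan_Suc_shift) simp
  also have "\<dots> = (\<Sum>i<K. sc (of_int (p + 1)) (sc (of_int p gchoose i) (Y a (int i - q) b)))"
    unfolding gbinomial_absorption by simp
  also have "\<dots> = sc (of_int (p + 1)) (R p q a b)"
    by (subst R_eq_sum[of K]) (use K in \<open>auto simp: vs.scale_sum_right\<close>)
  finally show ?thesis .
qed

lemma circ_eq: "circ V n a b = R (wt V a + int n) (2 * int n + 2) a b"
  by (simp add: circ_def R_def algebra_simps)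

lemma star_h_eq:
  "star_h V n a b = (\<Sum>m = 0..n. sc ((-1)^m * of_nat ((m + n) choose n)) (R (wt V a + int n) (int n + int m + 1) a b))"
  by (simp add: star_h_def R_def algebra_simps)

section \<open>The Borcherds identity integrated in two variables\<close>

lemma gbinomial_convolution:
  fixes \<alpha> \<beta> :: complex
  assumes Z: "\<And>t. t \<ge> K \<Longrightarrow> Z t = 0"
  shows "(\<Sum>i<K. \<Sum>j<K. sc ((\<alpha> gchoose i) * (\<beta> gchoose j)) (Z (i + j)))
       = (\<Sum>t<K. sc (\<alpha> + \<beta> gchoose t) (Z t))"
proof -
  have "(\<Sum>i<K. \<Sum>j<K. sc ((\<alpha> gchoose i) * (\<beta> gchoose j)) (Z (i + j)))
      = (\<Sum>(i,j)\<in>{..<K} \<times> {..<K}. sc ((\<alpha> gchoose i) * (\<beta> gchoose j)) (Z (i + j)))"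
    by (simp add: sum.cartesian_product)
  also have "\<dots> = (\<Sum>(i,j)\<in>{(i,j). i + j < K}. sc ((\<alpha> gchoose i) * (\<beta> gchoose j)) (Z (i + j)))"
    by (rule sum.mono_neutral_right) (use Z in \<open>auto, metis not_less\<close>)
  also have "\<dots> = (\<Sum>t<K. \<Sum>i\<le>t. sc ((\<alpha> gchoose i) * (\<beta> gchoose (t - i))) (Z t))"
    by (simp add: sum.triangle_reindex)
  also have "\<dots> = (\<Sum>t<K. sc (\<alpha> + \<beta> gchoose t) (Z t))"
    by (simp add: atLeast0AtMost flip: vs.scale_sum_left gbinomial_Vandermonde)
  finally show ?thesis .
qed

text \<open>Coefficient form of applying \<open>z^h / h!\<close> times the h-th derivative to
  \<open>(1+z)^alpha\<close>, which yields
  \<open>binomial(alpha, h) z^h (1+z)^(alpha-h)\<close>.\<close>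

lemma gbinomial_shift:
  fixes \<alpha> :: complex
  assumes Z: "\<And>t. t \<ge> K \<Longrightarrow> Z t = 0"
  shows "(\<Sum>i<K. sc ((\<alpha> gchoose i) * (of_nat i gchoose h)) (Z i))
       = (\<Sum>i<K. sc ((\<alpha> gchoose h) * (\<alpha> - of_nat h gchoose i)) (Z (h + i)))"
proof -
  have "(\<Sum>i<K. sc ((\<alpha> gchoose i) * (of_nat i gchoose h)) (Z i))
      = (\<Sum>i<K+h. sc ((\<alpha> gchoose i) * (of_nat i gchoose h)) (Z i))"
    by (rule sum.mono_neutral_left) (auto simp: Z)
  also have "\<dots> = (\<Sum>i\<in>{h..<K+h}. sc ((\<alpha> gchoose i) * (of_nat i gchoose h)) (Z i))"
    by (rule sum.mono_neutral_right) (auto simp: gbinomial_mult_choose)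
  also have "\<dots> = (\<Sum>i\<in>{h..<K+h}. sc ((\<alpha> gchoose h) * (\<alpha> - of_nat h gchoose (i - h))) (Z i))"
    by (rule sum.cong) (auto simp: gbinomial_mult_choose)
  also have "\<dots> = (\<Sum>i<K. sc ((\<alpha> gchoose h) * (\<alpha> - of_nat h gchoose i)) (Z (h + i)))"
    by (rule sum.reindex_bij_witness[of _ "\<lambda>i. h + i" "\<lambda>i. i - h"]) auto
  finally show ?thesis .
qed

text \<open>Truncation alone bounds \<open>i\<close> for each inner vector separately. The inner
  vector vanishes unless \<open>j\<close> and \<open>l\<close> are below \<open>J\<close>, so adding
  up finitely many bounds gives one that serves for all.\<close>

lemma Y_Y_bound:
  "\<exists>K. \<forall>i j l. (j \<ge> K \<or> l \<ge> K \<longrightarrow> Y y (Q + int j + int l) b = 0) \<and>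
          (i \<ge> K \<longrightarrow> Y x (P + int i - int l) (Y y (Q + int j + int l) b) = 0)"
proof -
  obtain S where S: "\<forall>k\<ge>int S. Y y k b = 0" using Y_trunc by blast
  define J where "J = S + nat (- Q)"
  have J: "Y y (Q + int j + int l) b = 0" if "j \<ge> J \<or> l \<ge> J" for j l
    using S that by (auto simp: J_def)
  define N where "N = (\<lambda>j l. SOME K. \<forall>k\<ge>int K. Y x k (Y y (Q + int j + int l) b) = 0)"
  have N: "Y x k (Y y (Q + int j + int l) b) = 0" if "k \<ge> int (N j l)" for j l k
    using someI_ex[OF Y_trunc[of x "Y y (Q + int j + int l) b"]] that unfolding N_def by blast
  define K where "K = J + nat (- P) + J + (\<Sum>j<J. \<Sum>l<J. N j l)"
  have "Y x (P + int i - int l) (Y y (Q + int j + int l) b) = 0" if "i \<ge> K" for i j l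
  proof (cases "j \<ge> J \<or> l \<ge> J")
    case False
    have "N j l \<le> (\<Sum>l<J. N j l)" using False by (intro member_le_sum) auto
    also have "\<dots> \<le> (\<Sum>j<J. \<Sum>l<J. N j l)"
      using False by (intro member_le_sum[of j _ "\<lambda>j. \<Sum>l<J. N j l"]) auto
    finally have "int (N j l) \<le> P + int i - int l"
      using that False by (auto simp: K_def)
    thus ?thesis by (rule N)
  qed (simp add: J)
  moreover have "K \<ge> J" by (simp add: K_def)
  ultimately show ?thesis using J by (intro exI[of _ K]) auto
qed

lemma Y_iterate_bound:
  "\<exists>K. \<forall>l t. l \<ge> K \<or> t \<ge> K \<longrightarrow> Y (Y x (r + int l) y) (P + int t - int l) b = 0"
proof -
  obtain S where S: "\<forall>k\<ge>int S. Y x k y = 0" using Y_trunc by blast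
  define J where "J = S + nat (- r)"
  have J: "Y x (r + int l) y = 0" if "l \<ge> J" for l
    using S that by (auto simp: J_def)
  define N where "N = (\<lambda>l. SOME K. \<forall>k\<ge>int K. Y (Y x (r + int l) y) k b = 0)"
  have N: "Y (Y x (r + int l) y) k b = 0" if "k \<ge> int (N l)" for l k
    using someI_ex[OF Y_trunc[of "Y x (r + int l) y" b]] that unfolding N_def by blast
  define K where "K = J + nat (- P) + J + (\<Sum>l<J. N l)"
  have "Y (Y x (r + int l) y) (P + int t - int l) b = 0" if "t \<ge> K" for l t
  proof (cases "l \<ge> J")
    case False
    have "N l \<le> (\<Sum>l<J. N l)" using False by (intro member_le_sum) auto
    hence "int (N l) \<le> P + int t - int l"
      using that False by (auto simp: K_def)
    thus ?thesis by (rule N)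
  qed (simp add: J)
  moreover have "K \<ge> J" by (simp add: K_def)
  ultimately show ?thesis using J by (intro exI[of _ K]) auto
qed

lemma R_R_eq:
  assumes "\<And>j. j \<ge> K \<Longrightarrow> Y y (int j - q2) b = 0"
    and "\<And>i j. i \<ge> K \<Longrightarrow> Y x (int i - q1) (Y y (int j - q2) b) = 0"
  shows "R A q1 x (R B q2 y b) = (\<Sum>i<K. \<Sum>j<K. sc ((of_int A gchoose i) * (of_int B gchoose j))
           (Y x (int i - q1) (Y y (int j - q2) b)))"
proof -
  have 1: "R B q2 y b = (\<Sum>j<K. sc (of_int B gchoose j) (Y y (int j - q2) b))"
    by (rule R_eq_sum) (rule assms)
  show ?thesis unfolding 1
    by (subst R_eq_sum[of K])
       (simp_all add: assms(2) Y_sum_right Y_scl_right vs.scale_sum_right)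
qed

text \<open>The Borcherds identity integrated over both variables against
  \<open>(1+z\<^sub>1)^A z\<^sub>1^p (1+z\<^sub>2)^B z\<^sub>2^q (z\<^sub>1-z\<^sub>2)^r\<close>.\<close>
lemma borcherds_R:
  "fsum (\<lambda>l. \<Sum>h\<le>l. sc ((of_int p gchoose (l - h)) * (of_int A gchoose h))
        (R (A + B - int h) (int l - int h - p - q) (Y x (r + int l) y) b))
   = fsum (\<lambda>l. sc ((-1)^l * (of_int r gchoose l)) (R A (int l - p - r) x (R B (- q - int l) y b)))
   - sc (sgn_pow r) (fsum (\<lambda>l. sc ((-1)^l * (of_int r gchoose l))
        (R B (int l - q - r) y (R A (- p - int l) x b))))"
proof -
  define cA cB where "cA = (\<lambda>i. (of_int A :: complex) gchoose i)" "cB = (\<lambda>i. (of_int B :: complex) gchoose i)"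
  define e where "e = (\<lambda>l. (-1)^l * ((of_int r :: complex) gchoose l))"
  define Z where "Z = (\<lambda>l t. Y (Y x (r + int l) y) (p + q + int t - int l) b)"
  obtain K1 where K1: "\<forall>i j l. (j \<ge> K1 \<or> l \<ge> K1 \<longrightarrow> Y y (q + int j + int l) b = 0) \<and>
          (i \<ge> K1 \<longrightarrow> Y x (p + r + int i - int l) (Y y (q + int j + int l) b) = 0)"
    using Y_Y_bound by blast
  obtain K2 where K2: "\<forall>i j l. (j \<ge> K2 \<or> l \<ge> K2 \<longrightarrow> Y x (p + int j + int l) b = 0) \<and>
          (i \<ge> K2 \<longrightarrow> Y y (q + r + int i - int l) (Y x (p + int j + int l) b) = 0)"
    using Y_Y_bound by blast
  obtain K3 where K3: "\<forall>l t. l \<ge> K3 \<or> t \<ge> K3 \<longrightarrow> Z l t = 0"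
    unfolding Z_def using Y_iterate_bound by blast
  \<comment> \<open>A single bound makes all the sums finite over the same range, so that they can
    be interchanged.\<close>
  define K where "K = max K1 (max K2 K3)"
  have y0: "Y y (q + int j + int l) b = 0" if "j \<ge> K \<or> l \<ge> K" for j l
    using K1 that by (auto simp: K_def)
  have xy0: "Y x (p + r + int i - int l) (Y y (q + int j + int l) b) = 0" if "i \<ge> K" for i j l
    using K1 that by (auto simp: K_def)
  have x0: "Y x (p + int j + int l) b = 0" if "j \<ge> K \<or> l \<ge> K" for j l
    using K2 that by (auto simp: K_def)
  have yx0: "Y y (q + r + int i - int l) (Y x (p + int j + int l) b) = 0" if "i \<ge> K" for i j l
    using K2 that by (auto simp: K_def)
  have Z0: "Z l t = 0" if "l \<ge> K \<or> t \<ge> K" for l t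
    using K3 that by (auto simp: K_def)

  \<comment> \<open>The Borcherds identity for the modes \<open>p + i\<close> and
    \<open>q + j\<close>. Weighted with \<open>cA i * cB j\<close> and summed over \<open>i\<close>
    and \<open>j\<close>, it gives the claim.\<close>
  have pointwise: "(\<Sum>l<K. sc (of_int (p + int i) gchoose l) (Z l (i + j)))
     = (\<Sum>l<K. sc (e l) (Y x (p + r + int i - int l) (Y y (q + int j + int l) b)))
     - sc (sgn_pow r) (\<Sum>l<K. sc (e l) (Y y (q + r + int j - int l) (Y x (p + int i + int l) b)))" for i j
  proof -
    have 1: "fsum (\<lambda>l. sc (of_int (p + int i) gchoose l) (Y (Y x (r + int l) y) (p + int i + (q + int j) - int l) b))
        = (\<Sum>l<K. sc (of_int (p + int i) gchoose l) (Y (Y x (r + int l) y) (p + int i + (q + int j) - int l) b))"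
      by (rule fsum_eq_sum) (use Z0[of _ "i + j"] in \<open>simp add: Z_def algebra_simps\<close>)
    have 2: "fsum (\<lambda>l. sc ((-1)^l * (of_int r gchoose l)) (Y x (p + int i + r - int l) (Y y (q + int j + int l) b)))
        = (\<Sum>l<K. sc ((-1)^l * (of_int r gchoose l)) (Y x (p + int i + r - int l) (Y y (q + int j + int l) b)))"
      by (rule fsum_eq_sum) (simp add: y0)
    have 3: "fsum (\<lambda>l. sc ((-1)^l * (of_int r gchoose l)) (Y y (q + int j + r - int l) (Y x (p + int i + int l) b)))
        = (\<Sum>l<K. sc ((-1)^l * (of_int r gchoose l)) (Y y (q + int j + r - int l) (Y x (p + int i + int l) b)))"
      by (rule fsum_eq_sum) (simp add: x0)
    show ?thesis
      using borch[of "p + int i" x r y "q + int j" b] unfolding 1 2 3 e_def Z_def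
      by (simp add: algebra_simps)
  qed

  have R1: "R A (int l - p - r) x (R B (- q - int l) y b)
     = (\<Sum>i<K. \<Sum>j<K. sc (cA i * cB j) (Y x (p + r + int i - int l) (Y y (q + int j + int l) b)))" for l
  proof -
    have eq: "int i - (int l - p - r) = p + r + int i - int l" "int j - (- q - int l) = q + int j + int l" for i j
      by auto
    show ?thesis unfolding cA_cB_def
      by (subst R_R_eq[of K]) (simp_all only: eq, auto simp: y0 xy0)
  qed
  have R2: "R B (int l - q - r) y (R A (- p - int l) x b)
     = (\<Sum>i<K. \<Sum>j<K. sc (cA i * cB j) (Y y (q + r + int j - int l) (Y x (p + int i + int l) b)))" for l
  proof -
    have eq: "int i - (int l - q - r) = q + r + int i - int l" "int j - (- p - int l) = p + int j + int l" for i j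
      by auto
    have "R B (int l - q - r) y (R A (- p - int l) x b)
      = (\<Sum>j<K. \<Sum>i<K. sc (cB j * cA i) (Y y (q + r + int j - int l) (Y x (p + int i + int l) b)))"
      unfolding cA_cB_def by (subst R_R_eq[of K]) (simp_all only: eq, auto simp: x0 yx0)
    thus ?thesis by (subst sum.swap) (simp add: mult.commute)
  qed
  \<comment> \<open>On the iterate side \<open>i\<close> and \<open>j\<close> enter the mode only
    through \<open>i + j\<close>, but the coefficient still contains \<open>p + i\<close>.
    Vandermonde splits off \<open>i\<close>, which costs \<open>h\<close> powers of
    \<open>1+z\<close>; the remaining two powers of \<open>1+z\<close> merge.\<close>
  have R3: "(\<Sum>i<K. \<Sum>j<K. sc (cA i * cB j * (of_int (p + int i) gchoose l)) (Z l (i + j)))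
     = (\<Sum>h\<le>l. sc ((of_int p gchoose (l - h)) * cA h)
        (R (A + B - int h) (int l - int h - p - q) (Y x (r + int l) y) b))" for l
  proof -
    have inner: "(\<Sum>i<K. \<Sum>j<K. sc (cA i * (of_nat i gchoose h) * cB j) (Z l (i + j)))
       = sc (cA h) (R (A + B - int h) (int l - int h - p - q) (Y x (r + int l) y) b)" for h
    proof -
      define X where "X = (\<lambda>i. \<Sum>j<K. sc (cB j) (Z l (i + j)))"
      have "(\<Sum>i<K. \<Sum>j<K. sc (cA i * (of_nat i gchoose h) * cB j) (Z l (i + j)))
          = (\<Sum>i<K. sc (cA i * (of_nat i gchoose h)) (X i))"
        by (simp add: X_def vs.scale_sum_right)
      also have "\<dots> = (\<Sum>i<K. sc (cA h * (of_int A - of_nat h gchoose i)) (X (h + i)))"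
        unfolding cA_cB_def(1) by (rule gbinomial_shift) (simp add: X_def Z0)
      also have "\<dots> = sc (cA h) (\<Sum>i<K. \<Sum>j<K. sc ((of_int A - of_nat h gchoose i) * cB j) (Z l (h + (i + j))))"
        by (simp add: X_def vs.scale_sum_right add.assoc mult.assoc)
      also have "(\<Sum>i<K. \<Sum>j<K. sc ((of_int A - of_nat h gchoose i) * cB j) (Z l (h + (i + j))))
         = (\<Sum>t<K. sc (of_int A - of_nat h + of_int B gchoose t) (Z l (h + t)))"
        unfolding cA_cB_def(2) by (rule gbinomial_convolution) (simp add: Z0)
      also have "\<dots> = R (A + B - int h) (int l - int h - p - q) (Y x (r + int l) y) b"
      proof (subst R_eq_sum[of K])
        have eq: "Y (Y x (r + int l) y) (int t - (int l - int h - p - q)) b = Z l (h + t)" for t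
          by (simp add: Z_def algebra_simps)
        show "Y (Y x (r + int l) y) (int t - (int l - int h - p - q)) b = 0" if "t \<ge> K" for t
          unfolding eq using that by (simp add: Z0)
        show "(\<Sum>t<K. sc (of_int A - of_nat h + of_int B gchoose t) (Z l (h + t)))
          = (\<Sum>i<K. sc (of_int (A + B - int h) gchoose i) (Y (Y x (r + int l) y) (int i - (int l - int h - p - q)) b))"
          unfolding eq by (simp add: algebra_simps)
      qed
      finally show ?thesis .
    qed
    have "(\<Sum>i<K. \<Sum>j<K. sc (cA i * cB j * (of_int (p + int i) gchoose l)) (Z l (i + j)))
      = (\<Sum>i<K. \<Sum>j<K. \<Sum>h\<le>l. sc (of_int p gchoose (l - h)) (sc (cA i * (of_nat i gchoose h) * cB j) (Z l (i + j))))"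
      unfolding gbinomial_int_Vandermonde
      by (simp add: sum_distrib_left vs.scale_sum_left mult_ac)
    also have "\<dots> = (\<Sum>h\<le>l. sc (of_int p gchoose (l - h)) (\<Sum>i<K. \<Sum>j<K. sc (cA i * (of_nat i gchoose h) * cB j) (Z l (i + j))))"
      unfolding vs.scale_sum_right
      by (subst (2) sum.swap, subst sum.swap) (rule refl)
    finally show ?thesis by (simp add: inner)
  qed

  have swap3: "(\<Sum>i<K. \<Sum>j<K. sc (cA i * cB j) (\<Sum>l<K. sc (g i j l) (f i j l)))
    = (\<Sum>l<K. \<Sum>i<K. \<Sum>j<K. sc (cA i * cB j * g i j l) (f i j l))" for g f
    unfolding vs.scale_sum_right vs.scale_scale
    by (subst (2) sum.swap, subst sum.swap) (rule refl)

  have "(\<Sum>l<K. \<Sum>h\<le>l. sc ((of_int p gchoose (l - h)) * (of_int A gchoose h))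
        (R (A + B - int h) (int l - int h - p - q) (Y x (r + int l) y) b))
     = (\<Sum>i<K. \<Sum>j<K. sc (cA i * cB j) (\<Sum>l<K. sc (of_int (p + int i) gchoose l) (Z l (i + j))))"
    unfolding swap3 R3 by (simp add: cA_cB_def)
  also have "\<dots> = (\<Sum>i<K. \<Sum>j<K. sc (cA i * cB j)
         (\<Sum>l<K. sc (e l) (Y x (p + r + int i - int l) (Y y (q + int j + int l) b))))
     - sc (sgn_pow r) (\<Sum>i<K. \<Sum>j<K. sc (cA i * cB j)
         (\<Sum>l<K. sc (e l) (Y y (q + r + int j - int l) (Y x (p + int i + int l) b))))"
    unfolding pointwise vs.scale_right_diff_distrib sum_subtractf vs.scale_sum_right
    by (simp add: mult_ac)
  also have "(\<Sum>i<K. \<Sum>j<K. sc (cA i * cB j)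
         (\<Sum>l<K. sc (e l) (Y x (p + r + int i - int l) (Y y (q + int j + int l) b))))
     = (\<Sum>l<K. sc (e l) (R A (int l - p - r) x (R B (- q - int l) y b)))"
    unfolding swap3 R1 by (simp add: vs.scale_sum_right mult_ac)
  also have "(\<Sum>i<K. \<Sum>j<K. sc (cA i * cB j)
         (\<Sum>l<K. sc (e l) (Y y (q + r + int j - int l) (Y x (p + int i + int l) b))))
     = (\<Sum>l<K. sc (e l) (R B (int l - q - r) y (R A (- p - int l) x b)))"
    unfolding swap3 R2 by (simp add: vs.scale_sum_right mult_ac)
  also have "(\<Sum>l<K. \<Sum>h\<le>l. sc ((of_int p gchoose (l - h)) * (of_int A gchoose h))
        (R (A + B - int h) (int l - int h - p - q) (Y x (r + int l) y) b))
    = fsum (\<lambda>l. \<Sum>h\<le>l. sc ((of_int p gchoose (l - h)) * (of_int A gchoose h))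
        (R (A + B - int h) (int l - int h - p - q) (Y x (r + int l) y) b))"
  proof (rule fsum_eq_sum[symmetric])
    fix l assume l: "l \<ge> K"
    have "(\<Sum>h\<le>l. sc ((of_int p gchoose (l - h)) * cA h)
        (R (A + B - int h) (int l - int h - p - q) (Y x (r + int l) y) b)) = 0"
      unfolding R3[symmetric] using l by (simp add: Z0)
    thus "(\<Sum>h\<le>l. sc ((of_int p gchoose (l - h)) * (of_int A gchoose h))
        (R (A + B - int h) (int l - int h - p - q) (Y x (r + int l) y) b)) = 0"
      by (simp add: cA_cB_def)
  qed
  also have "(\<Sum>l<K. sc (e l) (R A (int l - p - r) x (R B (- q - int l) y b)))
     = fsum (\<lambda>l. sc (e l) (R A (int l - p - r) x (R B (- q - int l) y b)))"
    by (rule fsum_eq_sum[symmetric]) (simp add: R1 y0)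
  also have "(\<Sum>l<K. sc (e l) (R B (int l - q - r) y (R A (- p - int l) x b)))
     = fsum (\<lambda>l. sc (e l) (R B (int l - q - r) y (R A (- p - int l) x b)))"
    by (rule fsum_eq_sum[symmetric]) (simp add: R2 x0)
  finally show ?thesis unfolding e_def .
qed

section \<open>Residues lying in \<open>O_n(V)\<close>, and the product with a homogeneous left
  factor\<close>

lemma subspace_On: "vs.subspace (On V n)"
  by (simp add: On_def)

lemma OL_in_On: "L (-1) v + L 0 v \<in> On V n"
  unfolding On_def OL_def spn_eq by (rule vs.span_base) auto

lemma circ_in_On: "hom V a \<Longrightarrow> circ V n a b \<in> On V n"
  unfolding On_def Ocirc_def spn_eq by (intro vs.span_base UnI2) auto

lemma On_subsetI:
  assumes "vs.subspace S" "\<And>v. L (-1) v + L 0 v \<in> S" "\<And>a b. hom V a \<Longrightarrow> circ V n a b \<in> S"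
  shows "On V n \<subseteq> S"
proof -
  have "Ocirc V n \<subseteq> S"
    unfolding Ocirc_def spn_eq by (rule vs.span_minimal[OF _ assms(1)]) (use assms(3) in blast)
  moreover have "OL V \<subseteq> S"
    unfolding OL_def using assms(2) by blast
  ultimately show ?thesis
    unfolding On_def spn_eq by (intro vs.span_minimal[OF _ assms(1)]) blast
qed

text \<open>The pole order grows one step at a time: \<open>R_deriv\<close> and
  \<open>R_pascal\<close> express \<open>q R p (q+1) a b\<close> through residues of pole order
  \<open>q\<close> for \<open>L(-1) a\<close> and \<open>a\<close>. The induction ranges over all
  weights because \<open>L(-1) a\<close> has weight \<open>w + 1\<close>; division is possible as
  \<open>q >= 2n+2\<close>.\<close>

lemma R_pole_in_On:
  "a \<in> eigsp V w \<Longrightarrow> R (w + int n) (2 * int n + 2 + int m) a b \<in> On V n"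
proof (induction m arbitrary: a w)
  case 0
  show ?case
  proof (cases "a = 0")
    case False
    with 0 have "wt V a = w" "hom V a" by (auto intro: wt_eq eigsp_homI)
    thus ?thesis using circ_in_On[of a n b] by (simp add: circ_eq)
  qed (simp add: vs.subspace_0[OF subspace_On])
next
  case (Suc m)
  define p q where "p = w + int n" "q = 2 * int n + 2 + int m"
  have "R (p + 1) q (L (-1) a) b \<in> On V n"
    using Suc.IH[OF eigsp_Lm1[OF Suc.prems]] by (simp add: p_q_def add_ac)
  moreover have "R p q a b \<in> On V n"
    using Suc.IH[OF Suc.prems] by (simp add: p_q_def)
  moreover have "sc (of_int q) (R p (q + 1) a b)
      = R (p + 1) q (L (-1) a) b + sc (of_int (p + 1) - of_int q) (R p q a b)"
    unfolding R_deriv R_pascal[of p "q + 1"] by (simp add: vs.scale_right_distrib vs.scale_left_diff_distrib)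
  ultimately have "sc (of_int q) (R p (q + 1) a b) \<in> On V n"
    by (simp add: vs.subspace_add vs.subspace_scale subspace_On)
  hence "sc (inverse (of_int q)) (sc (of_int q) (R p (q + 1) a b)) \<in> On V n"
    by (rule vs.subspace_scale[OF subspace_On])
  moreover have "(of_int q :: complex) \<noteq> 0"
    unfolding of_int_eq_0_iff by (simp add: p_q_def)
  ultimately have "R p (q + 1) a b \<in> On V n" by simp
  thus ?case by (simp add: p_q_def add_ac)
qed

text \<open>By \<open>R_pascal\<close> each extra power of \<open>1+x\<close> costs at most one
  order of the pole, so the excess of the exponent over \<open>w + n\<close> has to be covered by
  the excess of the pole order over 2n+2.\<close>

lemma R_in_On:
  assumes "a \<in> eigsp V w" "w + int n \<le> p" "p - (w + int n) \<le> q - (2 * int n + 2)"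
  shows "R p q a b \<in> On V n"
proof -
  have *: "R (w + int n + int k) (2 * int n + 2 + int m) a b \<in> On V n" if "k \<le> m" for k m
    using that
  proof (induction k arbitrary: m)
    case 0
    then show ?case using R_pole_in_On[OF assms(1)] by simp
  next
    case (Suc k)
    have "R (w + int n + int (Suc k)) (2 * int n + 2 + int m) a b
       = R (w + int n + int k) (2 * int n + 2 + int m) a b + R (w + int n + int k) (2 * int n + 2 + int (m - 1)) a b"
      using R_pascal[of "w + int n + int k" "2 * int n + 2 + int m" a b] Suc.prems
      by (simp add: of_nat_diff algebra_simps)
    thus ?case
      using Suc.IH[of m] Suc.IH[of "m - 1"] Suc.prems by (simp add: vs.subspace_add[OF subspace_On])
  qed
  show ?thesis
    using *[of "nat (p - (w + int n))" "nat (q - (2 * int n + 2))"] assms(2,3) by simp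
qed

text \<open>The weight is an argument and not read off from \<open>a\<close>: this keeps the product
  linear in \<open>a\<close>, also at \<open>a = 0\<close>, where \<open>wt\<close> is
  unspecified.\<close>

definition starw :: "nat \<Rightarrow> int \<Rightarrow> 'v \<Rightarrow> 'v \<Rightarrow> 'v" where
  "starw n w a b = (\<Sum>m = 0..n. sc ((-1)^m * of_nat ((m + n) choose n)) (R (w + int n) (int n + int m + 1) a b))"

lemma star_h_starw: "a \<in> eigsp V w \<Longrightarrow> star_h V n a b = starw n w a b"
  by (cases "a = 0") (simp_all add: star_h_eq starw_def wt_eq)

lemma starw_linear:
  "starw n w (a + a') b = starw n w a b + starw n w a' b"
  "starw n w a (b + b') = starw n w a b + starw n w a b'"
  "starw n w (sc s a) b = sc s (starw n w a b)"
  "starw n w a (sc s b) = sc s (starw n w a b)"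
  by (simp_all add: starw_def R_add_left R_add_right R_scl vs.scale_right_distrib sum.distrib
        vs.scale_sum_right mult.commute)

lemma starw_zero [simp]: "starw n w 0 b = 0" "starw n w a 0 = 0"
  by (simp_all add: starw_def)

text \<open>Neighbouring terms cancel because
  \<open>(n+m+1) binomial(m+n, n) = (m+1) binomial(m+n+1, n)\<close>.\<close>

lemma telescope:
  "(\<Sum>m = 0..N. sc ((-1)^m * of_nat ((m + n) choose n))
      (sc (of_nat (n + m + 1)) (f (m + 1)) + sc (of_nat m) (f m)))
   = sc ((-1)^N * of_nat (n + N + 1) * of_nat ((N + n) choose n)) (f (N + 1))"
proof (induction N)
  case (Suc N)
  have "Suc (N + n) * ((N + n) choose n) = Suc N * (Suc N + n choose n)"
    using Suc_times_binomial[of N "N + n"] binomial_symmetric[of n "Suc N + n"]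
      binomial_symmetric[of n "N + n"] by simp
  hence *: "of_nat (n + N + 1) * of_nat ((N + n) choose n)
      = (of_nat (Suc N) * of_nat (Suc N + n choose n) :: complex)"
    unfolding of_nat_mult[symmetric] by (simp add: add.commute)
  define c d where "c = (-1)^Suc N * (of_nat ((Suc N + n) choose n) :: complex)"
    and "d = (-1)^N * of_nat (n + N + 1) * (of_nat ((N + n) choose n) :: complex)"
  have "d = - (c * of_nat (Suc N))"
    unfolding c_def d_def mult.assoc * by simp
  hence d: "sc d (f (N + 1)) = - sc c (sc (of_nat (Suc N)) (f (Suc N)))"
    by simp
  show ?case
    unfolding sum.atLeast0_atMost_Suc Suc.IH
    unfolding d_def[symmetric] c_def[symmetric] d vs.scale_right_distrib
    by (simp add: c_def mult_ac)
qed simp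

text \<open>Integration by parts brings each term into the form required by
  \<open>telescope\<close>; only a residue of pole order 2n+2 survives.\<close>

lemma star_deriv_in_On:
  assumes a: "a \<in> eigsp V w"
  shows "starw n (w + 1) (L (-1) a) b + sc (of_int w) (starw n w a b) \<in> On V n"
proof -
  define f where "f = (\<lambda>m. R (w + int n) (int n + int m + 1) a b)"
  have *: "R (w + 1 + int n) (int n + int m + 1) (L (-1) a) b + sc (of_int w) (f m)
      = sc (of_nat (n + m + 1)) (f (m + 1)) + sc (of_nat m) (f m)" for m
  proof -
    have "R (w + int n + 1) (int n + int m + 1) (L (-1) a) b
       = sc (of_int (int n + int m + 1)) (R (w + int n) (int n + int m + 2) a b + f m)
         - sc (of_int (w + int n + 1)) (f m)"
      using R_deriv[of "w + int n" "int n + int m + 1" a b] R_pascal[of "w + int n" "int n + int m + 2" a b]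
      by (simp add: f_def algebra_simps)
    thus ?thesis
      by (simp add: f_def algebra_simps vs.scale_left_distrib vs.scale_left_diff_distrib vs.scale_right_distrib)
  qed
  have "starw n (w + 1) (L (-1) a) b + sc (of_int w) (starw n w a b)
     = (\<Sum>m = 0..n. sc ((-1)^m * of_nat ((m + n) choose n))
          (R (w + 1 + int n) (int n + int m + 1) (L (-1) a) b + sc (of_int w) (f m)))"
    by (simp add: starw_def f_def vs.scale_right_distrib sum.distrib vs.scale_sum_right mult.commute)
  also have "\<dots> = sc ((-1)^n * of_nat (n + n + 1) * of_nat ((n + n) choose n)) (f (n + 1))"
    unfolding * telescope ..
  also have "f (n + 1) \<in> On V n"
    unfolding f_def by (rule R_in_On[OF a]) auto
  hence "sc ((-1)^n * of_nat (n + n + 1) * of_nat ((n + n) choose n)) (f (n + 1)) \<in> On V n"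
    by (rule vs.subspace_scale[OF subspace_On])
  finally show ?thesis .
qed

lemma R_Lm1_right: "R p q a (L (-1) b) = L (-1) (R p q a b) - R p q (L (-1) a) b"
proof -
  obtain K1 where K1: "\<forall>i\<ge>K1. Y a (int i - q) b = 0" using Y_bound by blast
  obtain K2 where K2: "\<forall>i\<ge>K2. Y (L (-1) a) (int i - q) b = 0" using Y_bound by blast
  obtain K3 where K3: "\<forall>i\<ge>K3. Y a (int i - q) (L (-1) b) = 0" using Y_bound by blast
  note * = K1 K2 K3
  define K where "K = max K1 (max K2 K3)"
  have 1: "R p q a b = (\<Sum>i<K. sc (of_int p gchoose i) (Y a (int i - q) b))"
    by (rule R_eq_sum) (simp add: * K_def)
  have 2: "R p q (L (-1) a) b = (\<Sum>i<K. sc (of_int p gchoose i) (Y (L (-1) a) (int i - q) b))"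
    by (rule R_eq_sum) (simp add: * K_def)
  have 3: "R p q a (L (-1) b) = (\<Sum>i<K. sc (of_int p gchoose i) (Y a (int i - q) (L (-1) b)))"
    by (rule R_eq_sum) (simp add: * K_def)
  have "Y a k (L (-1) b) = L (-1) (Y a k b) - Y (L (-1) a) k b" for k
    by (simp add: Lm1_comm Y_deriv)
  thus ?thesis unfolding 1 2 3
    by (simp add: L_sum L_scl vs.scale_right_diff_distrib sum_subtractf)
qed

text \<open>Residue form of \<open>[L(0), Y(a,x)] = w Y(a,x) + x Y(L(-1) a, x)\<close>.\<close>

lemma R_L0_right:
  assumes "a \<in> eigsp V w"
  shows "R p q a (L 0 b) = L 0 (R p q a b) - sc (of_int w) (R p q a b) - R p (q - 1) (L (-1) a) b"
proof -
  obtain K1 where K1: "\<forall>i\<ge>K1. Y a (int i - q) b = 0" using Y_bound by blast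
  obtain K2 where K2: "\<forall>i\<ge>K2. Y (L (-1) a) (int i - (q - 1)) b = 0" using Y_bound by blast
  obtain K3 where K3: "\<forall>i\<ge>K3. Y a (int i - q) (L 0 b) = 0" using Y_bound by blast
  note * = K1 K2 K3
  define K where "K = max K1 (max K2 K3)"
  have 1: "R p q a b = (\<Sum>i<K. sc (of_int p gchoose i) (Y a (int i - q) b))"
    by (rule R_eq_sum) (simp add: * K_def)
  have 2: "R p (q - 1) (L (-1) a) b = (\<Sum>i<K. sc (of_int p gchoose i) (Y (L (-1) a) (int i - (q - 1)) b))"
    by (rule R_eq_sum) (simp add: * K_def)
  have 3: "R p q a (L 0 b) = (\<Sum>i<K. sc (of_int p gchoose i) (Y a (int i - q) (L 0 b)))"
    by (rule R_eq_sum) (simp add: * K_def)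
  have "Y a (int i - q) (L 0 b) = L 0 (Y a (int i - q) b) - sc (of_int w) (Y a (int i - q) b)
      - Y (L (-1) a) (int i - (q - 1)) b" for i
    by (simp add: L0_comm[OF assms] Y_deriv algebra_simps vs.scale_left_distrib vs.scale_left_diff_distrib)
  thus ?thesis unfolding 1 2 3
    by (simp add: L_sum L_scl vs.scale_right_diff_distrib sum_subtractf vs.scale_sum_right mult.commute)
qed

text \<open>Commuting \<open>L(-1) + L(0)\<close> with \<open>Y(a,x)\<close> produces
  \<open>w Y(a,x) + (1+x) Y(L(-1) a, x)\<close>. The factor \<open>1+x\<close> supplies exactly the
  exponent that belongs to the weight \<open>w + 1\<close> of \<open>L(-1) a\<close>, so the defect
  is the element of \<open>star_deriv_in_On\<close>.\<close>

lemma starw_OL_right: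
  assumes a: "a \<in> eigsp V w"
  shows "starw n w a (L (-1) b + L 0 b) \<in> On V n"
proof -
  have *: "R (w + int n) q a (L (-1) b + L 0 b)
     = L (-1) (R (w + int n) q a b) + L 0 (R (w + int n) q a b)
       - (R (w + 1 + int n) q (L (-1) a) b + sc (of_int w) (R (w + int n) q a b))" for q
    using R_pascal[of "w + int n" q "L (-1) a" b]
    by (simp add: R_add_right R_Lm1_right R_L0_right[OF a] algebra_simps)
  have "starw n w a (L (-1) b + L 0 b)
     = (L (-1) (starw n w a b) + L 0 (starw n w a b))
       - (starw n (w + 1) (L (-1) a) b + sc (of_int w) (starw n w a b))"
    unfolding starw_def *
    by (simp add: L_sum L_scl vs.scale_right_diff_distrib vs.scale_right_distrib sum_subtractf sum.distrib
          vs.scale_sum_right mult.commute)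
  thus ?thesis
    using vs.subspace_diff[OF subspace_On OL_in_On star_deriv_in_On[OF a]] by simp
qed

text \<open>The exponent drops with \<open>l\<close> because the weight of
  \<open>x_(l-2n-2) y\<close> does; \<open>B\<close> below is chosen so that
  \<open>A + B - l\<close> is this weight plus n. In both products on the right of the Borcherds
  identity the outer residue lies in \<open>O_n(V)\<close>: for \<open>y\<close> the exponent
  exceeds \<open>wy + n\<close> by n+1, which is why \<open>q >= n+1\<close> is required.\<close>

lemma R_R_left_in_On:
  assumes x: "x \<in> eigsp V wx" and y: "y \<in> eigsp V wy" and q: "q \<ge> int n + 1"
  shows "fsum (\<lambda>l. sc (of_int (wx + int n) gchoose l)
           (R (wx + wy + 3 * int n + 1 - int l) q (Y x (int l - 2 * int n - 2) y) b)) \<in> On V n"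
proof -
  define A B r where "A = wx + int n" "B = wy + 2 * int n + 1" "r = - 2 * int n - 2"
  have collapse: "(\<Sum>h\<le>l. sc ((of_int 0 gchoose (l - h)) * (of_int A gchoose h)) (g h)) = sc (of_int A gchoose l) (g l)" for g l
  proof -
    have "(\<Sum>h\<le>l. sc ((of_int 0 gchoose (l - h)) * (of_int A gchoose h)) (g h))
      = (\<Sum>h\<in>{l}. sc ((of_int 0 gchoose (l - h)) * (of_int A gchoose h)) (g h))"
      by (rule sum.mono_neutral_right) (auto simp: gbinomial_0_left)
    thus ?thesis by simp
  qed
  have "fsum (\<lambda>l. sc (of_int A gchoose l) (R (A + B - int l) q (Y x (r + int l) y) b))
     = fsum (\<lambda>l. sc ((-1)^l * (of_int r gchoose l)) (R A (int l - r) x (R B (q - int l) y b)))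
   - sc (sgn_pow r) (fsum (\<lambda>l. sc ((-1)^l * (of_int r gchoose l))
        (R B (int l + q - r) y (R A (- int l) x b))))"
    using borcherds_R[of 0 A B "- q" x r y b] unfolding collapse by simp
  also have "\<dots> \<in> On V n"
  proof (intro vs.subspace_diff vs.subspace_scale fsum_in subspace_On)
    show "R A (int l - r) x z \<in> On V n" for l z
      by (rule R_in_On[OF x]) (auto simp: A_B_r_def)
    show "R B (int l + q - r) y z \<in> On V n" for l z
      by (rule R_in_On[OF y]) (use q in \<open>auto simp: A_B_r_def\<close>)
  qed
  finally show ?thesis by (simp add: A_B_r_def algebra_simps)
qed

text \<open>The case \<open>r = 0\<close>, a commutator of two residues. The iterate
  \<open>x_l y\<close> has weight \<open>wx + wy - l - 1\<close>, so its exponent is in excess by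
  \<open>n + 1 + l - h\<close> and its pole order by \<open>q1 + l - h\<close>; hence the bound on
  \<open>q1\<close>.\<close>

lemma R_R_right_in_On:
  assumes x: "x \<in> eigsp V wx" and y: "y \<in> eigsp V wy" and q: "q1 \<ge> int n + 1"
  shows "R (wx + int n) q1 x (R (wy + int n) (2 * int n + 2) y b) \<in> On V n"
proof -
  define A B q2 where "A = wx + int n" "B = wy + int n" "q2 = 2 * int n + 2"
  have collapse: "fsum (\<lambda>l. sc ((-1)^l * (of_int 0 gchoose l)) (g l)) = g 0" for g
    by (subst fsum_eq_sum[of 1]) (auto simp: gbinomial_0_left)
  have "R A q1 x (R B q2 y b) = fsum (\<lambda>l. \<Sum>h\<le>l. sc ((of_int (- q1) gchoose (l - h)) * (of_int A gchoose h))
        (R (A + B - int h) (int l - int h + q1 + q2) (Y x (int l) y) b)) + R B q2 y (R A q1 x b)"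
    using borcherds_R[of "- q1" A B "- q2" x 0 y b] unfolding collapse by (simp add: sgn_pow_def)
  also have "\<dots> \<in> On V n"
  proof (intro vs.subspace_add fsum_in vs.subspace_sum vs.subspace_scale subspace_On)
    show "R B q2 y z \<in> On V n" for z
      by (rule R_in_On[OF y]) (auto simp: A_B_q2_def)
    show "R (A + B - int h) (int l - int h + q1 + q2) (Y x (int l) y) b \<in> On V n" if "h \<in> {..l}" for h l
      by (rule R_in_On[OF eigsp_Y[OF x y]]) (use q that in \<open>auto simp: A_B_q2_def\<close>)
  qed
  finally show ?thesis by (simp add: A_B_q2_def)
qed

section \<open>Weight decompositions and the ideal property of \<open>O_n(V)\<close>\<close>

lemma eigsp_independent:
  assumes "finite F" "\<And>m. m \<in> F \<Longrightarrow> x m \<in> eigsp V m" "(\<Sum>m\<in>F. x m) = 0" "m \<in> F"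
  shows "x m = 0"
  using assms
proof (induction F arbitrary: x m rule: finite_induct)
  case (insert k F)
  \<comment> \<open>\<open>L(0) - k\<close> removes the component of weight \<open>k\<close> and
    multiplies the others by nonzero scalars.\<close>
  have "L 0 (\<Sum>m\<in>insert k F. x m) - sc (of_int k) (\<Sum>m\<in>insert k F. x m) = 0"
    using insert.prems(2) by simp
  moreover have "L 0 (\<Sum>m\<in>insert k F. x m) = (\<Sum>m\<in>insert k F. sc (of_int m) (x m))"
    unfolding L_sum using insert.prems(1) by (intro sum.cong) (auto simp: eigsp_def)
  ultimately have "(\<Sum>m\<in>insert k F. sc (of_int m - of_int k) (x m)) = 0"
    by (simp add: vs.scale_left_diff_distrib sum_subtractf vs.scale_sum_right)
  hence *: "(\<Sum>m\<in>F. sc (of_int m - of_int k) (x m)) = 0"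
    using insert.hyps by simp
  have x0: "x j = 0" if "j \<in> F" for j
  proof -
    have "sc (of_int j - of_int k) (x j) = 0"
      by (rule insert.IH[OF _ * that]) (use insert.prems(1) in \<open>auto intro: vs.subspace_scale subspace_eigsp\<close>)
    moreover have "j \<noteq> k" using that insert.hyps by auto
    ultimately show ?thesis by simp
  qed
  hence "x k = 0" using insert.prems(2) insert.hyps by simp
  with x0 insert.prems(3) show ?case by auto
qed simp

text \<open>The components form a total function vanishing off \<open>F\<close>, so that
  decompositions over different finite sets can be added and compared pointwise.\<close>

definition decomp :: "int set \<Rightarrow> (int \<Rightarrow> 'v) \<Rightarrow> 'v \<Rightarrow> bool" where
  "decomp F x v \<longleftrightarrow> finite F \<and> (\<forall>m. x m \<in> eigsp V m) \<and> (\<forall>m. m \<notin> F \<longrightarrow> x m = 0) \<and> v = (\<Sum>m\<in>F. x m)"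

lemma decomp_mono:
  assumes "decomp F x v" "F \<subseteq> F'" "finite F'"
  shows "decomp F' x v"
proof -
  have "(\<Sum>m\<in>F. x m) = (\<Sum>m\<in>F'. x m)"
    by (rule sum.mono_neutral_left) (use assms in \<open>auto simp: decomp_def\<close>)
  thus ?thesis using assms by (auto simp: decomp_def)
qed

lemma decomp_add:
  assumes "decomp F x v" "decomp F' x' v'"
  shows "decomp (F \<union> F') (\<lambda>m. x m + x' m) (v + v')"
proof -
  have fin: "finite (F \<union> F')" using assms by (simp add: decomp_def)
  have "decomp (F \<union> F') x v" "decomp (F \<union> F') x' v'"
    by (rule decomp_mono[OF assms(1) _ fin], simp, rule decomp_mono[OF assms(2) _ fin], simp)
  thus ?thesis by (auto simp: decomp_def sum.distrib intro: vs.subspace_add subspace_eigsp)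
qed

lemma decomp_scl: "decomp F x v \<Longrightarrow> decomp F (\<lambda>m. sc s (x m)) (sc s v)"
  by (auto simp: decomp_def vs.scale_sum_right intro: vs.subspace_scale subspace_eigsp)

lemma decomp_single: "v \<in> eigsp V m \<Longrightarrow> decomp {m} (\<lambda>k. if k = m then v else 0) v"
  by (auto simp: decomp_def vs.subspace_0[OF subspace_eigsp])

lemma decomp_unique:
  assumes "decomp F x v" "decomp F' x' v"
  shows "x m = x' m"
proof -
  have "decomp (F \<union> F') (\<lambda>m. x m + sc (-1) (x' m)) (v + sc (-1) v)"
    by (intro decomp_add decomp_scl assms)
  hence *: "decomp (F \<union> F') (\<lambda>m. x m - x' m) 0" by simp
  show ?thesis
  proof (cases "m \<in> F \<union> F'")
    case True
    have "x m - x' m = 0"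
      by (rule eigsp_independent[of "F \<union> F'" "\<lambda>m. x m - x' m", OF _ _ _ True])
         (use * in \<open>auto simp: decomp_def\<close>)
    thus ?thesis by simp
  qed (use assms in \<open>auto simp: decomp_def\<close>)
qed

lemma span_decomp:
  assumes "v \<in> vs.span (\<Union>m\<in>M. eigsp V m)"
  shows "\<exists>F x. decomp F x v \<and> F \<subseteq> M"
  using assms
proof (induction rule: vs.span_induct_alt)
  case base
  have "decomp {} (\<lambda>_. 0) 0" by (simp add: decomp_def vs.subspace_0[OF subspace_eigsp])
  thus ?case by blast
next
  case (step c a y)
  then obtain m F x where "m \<in> M" "a \<in> eigsp V m" "decomp F x y" "F \<subseteq> M" by blast
  thus ?case
    using decomp_add[OF decomp_scl[OF decomp_single[of a m], of c]] by blast
qed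

lemma decomp_exists: "\<exists>F x. decomp F x v"
  using span_decomp[of v UNIV] span_eigsp[of v] by auto

text \<open>The definite description in \<open>hcomp\<close> is met by a unique vector because
  weight decompositions are unique.\<close>

lemma hcomp_decomp:
  assumes "decomp F x v"
  shows "hcomp V m v = x m"
  unfolding hcomp_def spn_eq
proof (rule the_equality, intro conjI)
  show "x m \<in> eigsp V m" using assms by (simp add: decomp_def)
  have F': "decomp (insert m F) x v"
    by (rule decomp_mono[OF assms]) (use assms in \<open>auto simp: decomp_def\<close>)
  hence "v - x m = (\<Sum>k\<in>F-{m}. x k)"
    by (auto simp: decomp_def sum.insert_remove)
  also have "\<dots> \<in> vs.span (\<Union>m'\<in>-{m}. eigsp V m')"
    using assms by (intro vs.span_sum vs.span_base) (auto simp: decomp_def)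
  finally show "v - x m \<in> vs.span (\<Union>m'\<in>-{m}. eigsp V m')" .
next
  fix w assume w: "w \<in> eigsp V m \<and> v - w \<in> vs.span (\<Union>m'\<in>-{m}. eigsp V m')"
  then obtain G z where z: "decomp G z (v - w)" "G \<subseteq> -{m}" using span_decomp by blast
  have "decomp (G \<union> {m}) (\<lambda>k. z k + (if k = m then w else 0)) (v - w + w)"
    using w by (intro decomp_add decomp_single z) auto
  hence "x m = z m + (if m = m then w else 0)"
    using decomp_unique[OF assms] by simp
  moreover have "z m = 0" using z by (auto simp: decomp_def)
  ultimately show "w = x m" by simp
qed

lemma star_decomp:
  assumes "decomp F x a"
  shows "star V n a b = (\<Sum>m\<in>F. starw n m (x m) b)"
proof -
  have "star V n a b = (\<Sum>m\<in>{m. x m \<noteq> 0}. star_h V n (x m) b)"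
    by (simp add: star_def hcomp_decomp[OF assms])
  also have "\<dots> = (\<Sum>m\<in>{m. x m \<noteq> 0}. starw n m (x m) b)"
    using assms by (intro sum.cong star_h_starw) (auto simp: decomp_def)
  also have "\<dots> = (\<Sum>m\<in>F. starw n m (x m) b)"
    by (rule sum.mono_neutral_left) (use assms in \<open>auto simp: decomp_def\<close>)
  finally show ?thesis .
qed

lemma star_hom:
  assumes "a \<in> eigsp V w"
  shows "star V n a b = starw n w a b"
  using star_decomp[OF decomp_single[OF assms]] by simp

lemma star_add_left: "star V n (a + a') b = star V n a b + star V n a' b"
proof -
  obtain F x F' x' where F: "decomp F x a" and F': "decomp F' x' a'" using decomp_exists by metis
  hence fin: "finite (F \<union> F')" by (simp add: decomp_def)
  have *: "decomp (F \<union> F') x a" "decomp (F \<union> F') x' a'"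
    by (rule decomp_mono[OF F _ fin], simp, rule decomp_mono[OF F' _ fin], simp)
  show ?thesis
    using star_decomp[OF decomp_add[OF *]] star_decomp[OF *(1)] star_decomp[OF *(2)]
    by (simp add: starw_linear sum.distrib)
qed

lemma star_scl_left: "star V n (sc s a) b = sc s (star V n a b)"
proof -
  obtain F x where *: "decomp F x a" using decomp_exists by metis
  show ?thesis
    using star_decomp[OF decomp_scl[OF *]] star_decomp[OF *]
    by (simp add: starw_linear vs.scale_sum_right)
qed

lemma star_add_right: "star V n a (b + b') = star V n a b + star V n a b'"
  and star_scl_right: "star V n a (sc s b) = sc s (star V n a b)"
proof -
  obtain F x where "decomp F x a" using decomp_exists by metis
  note * = star_decomp[OF this]
  show "star V n a (b + b') = star V n a b + star V n a b'"
    "star V n a (sc s b) = sc s (star V n a b)"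
    by (simp_all add: * starw_linear sum.distrib vs.scale_sum_right)
qed

lemma star_zero [simp]: "star V n 0 b = 0" "star V n a 0 = 0"
  using star_scl_left[of n 0 0 b] star_scl_right[of n a 0 0] by simp_all

lemma star_sum_left: "star V n (sum f A) b = (\<Sum>i\<in>A. star V n (f i) b)"
  by (induction A rule: infinite_finite_induct) (simp_all add: star_add_left)

lemma star_On_right:
  assumes "b \<in> On V n"
  shows "star V n a b \<in> On V n"
proof -
  have *: "starw n w a b \<in> On V n" if a: "a \<in> eigsp V w" for a w
  proof -
    have "On V n \<subseteq> {b. starw n w a b \<in> On V n}"
    proof (rule On_subsetI)
      show "vs.subspace {b. starw n w a b \<in> On V n}"
        by (rule vs.subspaceI)
           (auto simp: starw_linear vs.subspace_0 vs.subspace_add vs.subspace_scale subspace_On)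
      show "L (-1) v + L 0 v \<in> {b. starw n w a b \<in> On V n}" for v
        using starw_OL_right[OF a] by simp
      show "circ V n c d \<in> {b. starw n w a b \<in> On V n}" if "hom V c" for c d
      proof -
        have "R (w + int n) (int n + int m + 1) a (R (wt V c + int n) (2 * int n + 2) c d) \<in> On V n" for m
          by (rule R_R_right_in_On[OF a eigsp_wt[OF that]]) simp
        thus ?thesis
          by (simp add: starw_def circ_eq vs.subspace_sum vs.subspace_scale subspace_On)
      qed
    qed
    thus ?thesis using assms by blast
  qed
  obtain F x where F: "decomp F x a" using decomp_exists by metis
  show ?thesis
    unfolding star_decomp[OF F]
    by (intro vs.subspace_sum subspace_On *) (use F in \<open>auto simp: decomp_def\<close>)
qed

text \<open>The modes making up the circle product have different weights, and the product uses a
  different exponent for each. Collected by pole order, they are the combinations treated in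
  \<open>R_R_left_in_On\<close>.\<close>

lemma star_circ_left:
  assumes x: "x \<in> eigsp V wx" and y: "y \<in> eigsp V wy"
  shows "star V n (R (wx + int n) (2 * int n + 2) x y) b \<in> On V n"
proof -
  obtain K where K: "\<forall>i\<ge>K. Y x (int i - (2 * int n + 2)) y = 0" using Y_bound by blast
  define w' where "w' = (\<lambda>i. wx + wy - (int i - (2 * int n + 2)) - 1)"
  have eig: "Y x (int i - (2 * int n + 2)) y \<in> eigsp V (w' i)" for i
    unfolding w'_def by (rule eigsp_Y[OF x y])
  have "star V n (R (wx + int n) (2 * int n + 2) x y) b
     = (\<Sum>i<K. sc (of_int (wx + int n) gchoose i) (starw n (w' i) (Y x (int i - (2 * int n + 2)) y) b))"
    by (subst R_eq_sum[of K]) (use K in \<open>auto simp: star_sum_left star_scl_left star_hom[OF eig]\<close>)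
  also have "\<dots> = (\<Sum>m = 0..n. sc ((-1)^m * of_nat ((m + n) choose n))
      (\<Sum>i<K. sc (of_int (wx + int n) gchoose i)
        (R (w' i + int n) (int n + int m + 1) (Y x (int i - (2 * int n + 2)) y) b)))"
    unfolding starw_def vs.scale_sum_right
    by (subst sum.swap) (simp add: mult.commute)
  also have "\<dots> \<in> On V n"
  proof (rule vs.subspace_sum[OF subspace_On], rule vs.subspace_scale[OF subspace_On])
    fix m
    have "(\<Sum>i<K. sc (of_int (wx + int n) gchoose i)
        (R (w' i + int n) (int n + int m + 1) (Y x (int i - (2 * int n + 2)) y) b))
      = fsum (\<lambda>i. sc (of_int (wx + int n) gchoose i)
        (R (w' i + int n) (int n + int m + 1) (Y x (int i - (2 * int n + 2)) y) b))"
      by (rule fsum_eq_sum[symmetric]) (use K in auto)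
    also have "\<dots> \<in> On V n"
      using R_R_left_in_On[OF x y, of n "int n + int m + 1" b]
      by (simp add: w'_def algebra_simps)
    finally show "(\<Sum>i<K. sc (of_int (wx + int n) gchoose i)
        (R (w' i + int n) (int n + int m + 1) (Y x (int i - (2 * int n + 2)) y) b)) \<in> On V n" .
  qed
  finally show ?thesis .
qed

lemma star_On_left:
  assumes "a \<in> On V n"
  shows "star V n a b \<in> On V n"
proof -
  have "On V n \<subseteq> {a. star V n a b \<in> On V n}"
  proof (rule On_subsetI)
    show "vs.subspace {a. star V n a b \<in> On V n}"
      by (rule vs.subspaceI)
         (auto simp: star_add_left star_scl_left vs.subspace_0 vs.subspace_add vs.subspace_scale subspace_On)
    show "L (-1) v + L 0 v \<in> {a. star V n a b \<in> On V n}" for v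
    proof -
      obtain F x where F: "decomp F x v" using decomp_exists by metis
      have "star V n (L (-1) (x m) + L 0 (x m)) b \<in> On V n" for m
      proof -
        have xm: "x m \<in> eigsp V m" using F by (simp add: decomp_def)
        hence "L 0 (x m) = sc (of_int m) (x m)" by (simp add: eigsp_def)
        thus ?thesis
          using star_deriv_in_On[OF xm, of n b]
          by (simp add: star_add_left star_scl_left star_hom[OF xm] star_hom[OF eigsp_Lm1[OF xm]])
      qed
      moreover have "L (-1) v + L 0 v = (\<Sum>m\<in>F. L (-1) (x m) + L 0 (x m))"
        using F by (simp add: decomp_def L_sum sum.distrib)
      ultimately show ?thesis
        by (simp add: star_sum_left vs.subspace_sum subspace_On)
    qed
    show "circ V n c d \<in> {a. star V n a b \<in> On V n}" if "hom V c" for c d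
    proof -
      obtain F x where F: "decomp F x d" using decomp_exists by metis
      have "star V n (R (wt V c + int n) (2 * int n + 2) c (x m)) b \<in> On V n" for m
        by (rule star_circ_left[OF eigsp_wt[OF that]]) (use F in \<open>auto simp: decomp_def\<close>)
      moreover have "d = (\<Sum>m\<in>F. x m)" using F by (simp add: decomp_def)
      ultimately show ?thesis
        by (simp add: circ_eq R_sum_right star_sum_left vs.subspace_sum subspace_On)
    qed
  qed
  thus ?thesis using assms by blast
qed

section \<open>Monomials in the modes of \<open>u\<close> and their exponents\<close>

lemma umon_Nil [simp]: "umon V u [] w = w"
  and umon_Cons [simp]: "umon V u (k # ks) w = Y u (- int k) (umon V u ks w)"
  by (simp_all add: umon_def applyl_def)

lemma umon_append: "umon V u (ks @ ls) w = umon V u ks (umon V u ls w)"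
  by (induction ks) simp_all

lemma umon_0_right [simp]: "umon V u ks 0 = 0"
  by (induction ks) simp_all

lemma umon_scl_right: "umon V u ks (sc s w) = sc s (umon V u ks w)"
  by (induction ks) (simp_all add: Y_scl_right)

lemma umon_eigsp:
  assumes "u \<in> eigsp V m" "w \<in> eigsp V m'"
  shows "umon V u ks w \<in> eigsp V (m' + (\<Sum>k\<leftarrow>ks. m + int k - 1))"
proof (induction ks)
  case (Cons k ks)
  show ?case using eigsp_Y[OF assms(1) Cons.IH, of "- int k"] by (simp add: algebra_simps)
qed (simp add: assms)

text \<open>\<open>[L(-1), u_{-k}] = k u_{-k-1}\<close>, applied factor by factor.\<close>

lemma Lm1_umon:
  "L (-1) (umon V u ks w) = (\<Sum>p<length ks. sc (of_nat (ks ! p)) (umon V u (ks[p := Suc (ks ! p)]) w))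
     + umon V u ks (L (-1) w)"
proof (induction ks)
  case (Cons k ks)
  have e: "- int k - 1 = - 1 - int k" by simp
  have "L (-1) (umon V u (k # ks) w)
      = Y u (- int k) (L (-1) (umon V u ks w)) + sc (of_nat k) (Y u (- int (Suc k)) (umon V u ks w))"
    by (simp add: Lm1_comm e)
  also have "\<dots> = (\<Sum>p<length (k # ks). sc (of_nat ((k # ks) ! p)) (umon V u ((k # ks)[p := Suc ((k # ks) ! p)]) w))
     + umon V u (k # ks) (L (-1) w)"
    unfolding Cons.IH list.size(4) add_Suc_right add_0_right
    by (subst sum.lessThan_Suc_shift) (simp add: Y_add_right Y_sum_right Y_scl_right)
  finally show ?case .
qed simp

text \<open>Decreasing, as in \<open>uops\<close>: the normal form into which monomials are sorted
  by the permutation property.\<close>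

primrec explist :: "(nat \<Rightarrow> nat) \<Rightarrow> nat \<Rightarrow> nat list" where
  "explist i 0 = []"
| "explist i (Suc m) = replicate (i (Suc m)) (Suc m) @ explist i m"

lemma umon_replicate: "umon V u (replicate j k) w = (Y u (- int k) ^^ j) w"
  by (induction j) simp_all

lemma uops_explist: "uops V u i m w = umon V u (explist i m) w"
  by (induction m) (simp_all add: umon_append umon_replicate del: of_nat_Suc)

lemma count_explist: "count (mset (explist i m)) l = (if 1 \<le> l \<and> l \<le> m then i l else 0)"
  by (induction m) (auto simp: le_Suc_eq)

lemma explist_pos: "k \<in> set (explist i m) \<Longrightarrow> k \<ge> 1"
  by (induction m) auto

lemma sum_list_explist:
  fixes g :: "nat \<Rightarrow> 'b::semiring_1"
  shows "(\<Sum>k\<leftarrow>explist i m. g k) = (\<Sum>l = 1..m. of_nat (i l) * g l)"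
  by (induction m) (simp_all add: sum_list_replicate add.commute)

lemma length_explist: "length (explist i m) = (\<Sum>l = 1..m. i l)"
  by (induction m) (simp_all add: add.commute)

lemma sum_nth_explist:
  "(\<Sum>p<length (explist i m). g (explist i m ! p)) = (\<Sum>l = 1..m. sc (of_nat (i l)) (g l))"
proof -
  have rep: "sum_list (replicate j x) = sc (of_nat j) x" for j and x :: 'v
    by (induction j) (simp_all add: vs.scale_left_distrib)
  have "(\<Sum>k\<leftarrow>explist i m. g k) = (\<Sum>l = 1..m. sc (of_nat (i l)) (g l))"
    by (induction m) (simp_all add: rep add.commute)
  thus ?thesis by (simp add: sum_list_sum_nth atLeast0LessThan)
qed

lemma mset_explist_count:
  assumes "\<forall>k\<in>set ks. 1 \<le> k \<and> k \<le> m"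
  shows "mset (explist (count (mset ks)) m) = mset ks"
proof (rule multiset_eqI)
  fix l
  show "count (mset (explist (count (mset ks)) m)) l = count (mset ks) l"
  proof (cases "l \<in> set ks")
    case False
    hence "count (mset ks) l = 0" by (simp add: count_eq_zero_iff)
    thus ?thesis by (simp add: count_explist)
  qed (use assms in \<open>simp add: count_explist\<close>)
qed

lemma subspace_Fsp: "vs.subspace (Fsp V u r w)"
  by (simp add: Fsp_def)

lemma umon_in_Fsp: "length ks \<le> r \<Longrightarrow> \<forall>k\<in>set ks. k \<ge> 1 \<Longrightarrow> umon V u ks w \<in> Fsp V u r w"
  unfolding Fsp_def spn_eq by (rule vs.span_base) auto

lemma Fsp_subsetI:
  assumes "vs.subspace T" "\<And>ks. length ks \<le> r \<Longrightarrow> \<forall>k\<in>set ks. k \<ge> 1 \<Longrightarrow> umon V u ks w \<in> T"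
  shows "Fsp V u r w \<subseteq> T"
  unfolding Fsp_def spn_eq by (rule vs.span_minimal[OF _ assms(1)]) (use assms(2) in auto)

lemma umon_perm_commuting:
  assumes comm: "\<And>j1 j2 w. j1 \<ge> 1 \<Longrightarrow> j2 \<ge> 1 \<Longrightarrow> Y u (- j1) (Y u (- j2) w) = Y u (- j2) (Y u (- j1) w)"
    and "mset ks = mset ls" "\<forall>k\<in>set ks. k \<ge> 1"
  shows "umon V u ks w = umon V u ls w"
proof -
  have move: "umon V u (as @ k # bs) w = umon V u (k # as @ bs) w"
    if "k \<ge> 1" "\<forall>j\<in>set as. j \<ge> 1" for as bs k
    using that
  proof (induction as)
    case (Cons a as)
    thus ?case using comm[of "int a" "int k"] by simp
  qed simp
  show ?thesis using assms(2,3)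
  proof (induction ks arbitrary: ls)
    case (Cons k ks)
    hence "k \<in> set ls" by (metis list.set_intros(1) set_mset_mset)
    then obtain as bs where ls: "ls = as @ k # bs" by (meson split_list)
    have pos: "\<forall>j\<in>set ls. j \<ge> 1" using Cons.prems by (metis set_mset_mset)
    have "umon V u ks w = umon V u (as @ bs) w"
      by (rule Cons.IH) (use Cons.prems ls in auto)
    thus ?case using move[of k as bs] pos by (simp add: ls)
  qed simp
qed

lemma R_nonneg:
  assumes "p \<ge> 0"
  shows "R p q a b = (\<Sum>i\<le>nat p. sc (of_nat (nat p choose i)) (Y a (int i - q) b))"
proof -
  have *: "(of_int p gchoose i :: complex) = of_nat (nat p choose i)" for i
    using assms binomial_gbinomial[of "nat p" i, where ?'a = complex] by simp
  have "R p q a b = (\<Sum>i<Suc (nat p). sc (of_int p gchoose i) (Y a (int i - q) b))"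
    unfolding R_def by (rule fsum_eq_sum) (simp add: * binomial_eq_0)
  thus ?thesis by (simp add: * lessThan_Suc_atMost)
qed

end

section \<open>The permutation property for monomials in \<open>u\<close>\<close>

locale voa_perm = vertex_operator_algebra V for V :: "'v::ab_group_add voa" +
  fixes n :: nat and u :: 'v
  assumes n_pos: "n \<ge> 1"
    and u_hom: "hom V u"
    and wt_u: "wt V u \<ge> - int n"
    and subalg: "vertex_subalg V (Vu V u)"
    and perm: "perm_prop V u (Vu V u)"
begin

lemma u_eigsp: "u \<in> eigsp V (wt V u)"
  by (rule eigsp_wt[OF u_hom])

lemma subspace_Vu: "vs.subspace (Vu V u)"
  by (simp add: Vu_def)

lemma umon_in_Vu: "\<forall>k\<in>set ks. k \<ge> 1 \<Longrightarrow> umon V u ks vc \<in> Vu V u"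
  unfolding Vu_def spn_eq by (rule vs.span_base) auto

lemma vac_in_Vu: "vc \<in> Vu V u"
  using umon_in_Vu[of "[]"] by simp

lemma u_in_Vu: "u \<in> Vu V u"
  using umon_in_Vu[of "[1]"] by (simp add: Y_vac_right)

lemma Vu_subsetI:
  assumes "vs.subspace S" "\<And>ks. \<forall>k\<in>set ks. k \<ge> 1 \<Longrightarrow> umon V u ks vc \<in> S"
  shows "Vu V u \<subseteq> S"
  unfolding Vu_def spn_eq by (rule vs.span_minimal[OF _ assms(1)]) (use assms(2) in auto)

text \<open>A monomial is homogeneous, so its product with \<open>b\<close> is a combination of its
  modes applied to \<open>b\<close>, and these stay in the vertex subalgebra.\<close>

lemma star_Vu:
  assumes "a \<in> Vu V u" "b \<in> Vu V u"
  shows "star V n a b \<in> Vu V u"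
proof -
  have "Vu V u \<subseteq> {a. star V n a b \<in> Vu V u}"
  proof (rule Vu_subsetI)
    show "vs.subspace {a. star V n a b \<in> Vu V u}"
      by (rule vs.subspaceI)
         (auto simp: star_add_left star_scl_left vs.subspace_0 vs.subspace_add vs.subspace_scale subspace_Vu)
    fix ks :: "nat list" assume "\<forall>k\<in>set ks. k \<ge> 1"
    hence "umon V u ks vc \<in> Vu V u" by (rule umon_in_Vu)
    hence "Y (umon V u ks vc) k b \<in> Vu V u" for k
      using subalg assms(2) by (simp add: vertex_subalg_def)
    thus "umon V u ks vc \<in> {a. star V n a b \<in> Vu V u}"
      unfolding mem_Collect_eq star_hom[OF umon_eigsp[OF u_eigsp vac_eigsp]] starw_def R_def
      by (intro vs.subspace_sum vs.subspace_scale fsum_in subspace_Vu)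
  qed
  thus ?thesis using assms(1) by blast
qed

text \<open>Unlike \<open>umon\<close>, this also covers the nonnegative modes.\<close>
definition zmon :: "int list \<Rightarrow> 'v \<Rightarrow> 'v" where
  "zmon ks w = applyl V (map (\<lambda>k. (u, k)) ks) w"

lemma zmon_Nil [simp]: "zmon [] w = w"
  and zmon_Cons [simp]: "zmon (k # ks) w = Y u (- k) (zmon ks w)"
  by (simp_all add: zmon_def applyl_def)

lemma zmon_append: "zmon (ks @ ls) w = zmon ks (zmon ls w)"
  by (induction ks) simp_all

lemma zmon_0 [simp]: "zmon ks 0 = 0"
  by (induction ks) simp_all

lemma umon_zmon: "umon V u ks w = zmon (map int ks) w"
  by (induction ks) simp_all

lemma zmon_perm_vac:
  assumes "mset ks = mset ls"
  shows "zmon ks vc - zmon ls vc \<in> Fsp V u (length ks - 1) vc"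
proof (cases "ks = []")
  case True
  thus ?thesis using assms by (simp add: vs.subspace_0 subspace_Fsp)
next
  case False
  let ?f = "map (\<lambda>k. (u, k))"
  have "applyl V (?f ks) vc - applyl V (?f ls) vc \<in> Fsp V u (length (?f ks) - 1) vc"
    using perm False assms u_in_Vu vac_in_Vu unfolding perm_prop_def
    by (elim allE[of _ "?f ks"] allE[of _ "?f ls"] allE[of _ vc] impE) auto
  thus ?thesis by (simp add: zmon_def)
qed

end

section \<open>Monomials acting on \<open>v_{-k} 1\<close> and their reduction to modes at most
  2n\<close>

locale voa_perm_vec = voa_perm V n u for V :: "'v::ab_group_add voa" and n u +
  fixes v :: 'v
  assumes v_hom: "hom V v"
    and u_v: "\<And>j. j \<ge> 0 \<Longrightarrow> Y u j v = 0"
begin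

definition w :: "nat \<Rightarrow> 'v" where
  "w k = Y v (- int k) vc"

lemma u_v_commute: "Y u p (Y v q c) = Y v q (Y u p c)"
  using commutator[of u p v q c] by (simp add: u_v)

lemma zmon_v_commute: "zmon ks (Y v q c) = Y v q (zmon ks c)"
  by (induction ks) (simp_all add: u_v_commute)

lemma u_nonneg_w: "j \<ge> 0 \<Longrightarrow> Y u j (w k) = 0"
  by (simp add: w_def u_v_commute Y_vac_right)

text \<open>\<open>v_{-k}\<close> commutes with the modes of \<open>u\<close>, so it transports the
  error terms of the permutation property from the vacuum to \<open>v_{-k} 1\<close>.\<close>

lemma Fsp_w:
  assumes "x \<in> Fsp V u r vc"
  shows "Y v (- int k) x \<in> Fsp V u r (w k)"
proof -
  have "Fsp V u r vc \<subseteq> {x. Y v (- int k) x \<in> Fsp V u r (w k)}"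
  proof (rule Fsp_subsetI)
    show "vs.subspace {x. Y v (- int k) x \<in> Fsp V u r (w k)}"
      by (rule vs.subspaceI)
         (auto simp: Y_add_right Y_scl_right vs.subspace_0 vs.subspace_add vs.subspace_scale subspace_Fsp)
    fix ks :: "nat list" assume "length ks \<le> r" "\<forall>k\<in>set ks. k \<ge> 1"
    hence "umon V u ks (w k) \<in> Fsp V u r (w k)" by (rule umon_in_Fsp)
    thus "umon V u ks vc \<in> {x. Y v (- int k) x \<in> Fsp V u r (w k)}"
      by (simp add: umon_zmon w_def zmon_v_commute)
  qed
  thus ?thesis using assms by blast
qed

lemma zmon_perm:
  assumes "mset ks = mset ls"
  shows "zmon ks (w k) - zmon ls (w k) \<in> Fsp V u (length ks - 1) (w k)"
  using Fsp_w[OF zmon_perm_vac[OF assms], of k] by (simp add: w_def zmon_v_commute Y_diff_right)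

lemma umon_perm:
  assumes "mset ks = mset ls"
  shows "umon V u ks (w k) - umon V u ls (w k) \<in> Fsp V u (length ks - 1) (w k)"
  using zmon_perm[of "map int ks" "map int ls" k] assms by (simp add: umon_zmon)

text \<open>The mode is moved to the far right, where it kills \<open>v_{-k} 1\<close>. The permuted
  list has one entry more than \<open>ks\<close>, so the error has degree
  \<open>length ks\<close>.\<close>

lemma nonneg_mode:
  assumes "j \<ge> 0"
  shows "Y u j (umon V u ks (w k)) \<in> Fsp V u (length ks) (w k)"
  using zmon_perm[of "(- j) # map int ks" "map int ks @ [- j]" k] u_nonneg_w[OF assms, of k]
  by (simp add: umon_zmon zmon_append)

lemma Lm1_w: "L (-1) (w k) = sc (of_nat k) (w (Suc k))"
proof -
  have e: "- int k - 1 = - 1 - int k" by simp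
  show ?thesis by (simp add: w_def Lm1_comm L_vac e)
qed

lemma w_eigsp: "w k \<in> eigsp V (wt V v + int k - 1)"
  using eigsp_Y[OF eigsp_wt[OF v_hom] vac_eigsp, of "- int k"] by (simp add: w_def)

definition T :: "'v set" where
  "T = vs.span ({uops V u i (2 * n) (w k) | i k. k \<ge> 1} \<union> On V n)"

lemma subspace_T: "vs.subspace T"
  by (simp add: T_def)

lemma On_subset_T: "On V n \<subseteq> T"
  unfolding T_def using vs.span_superset by blast

lemma uops_in_T: "k \<ge> 1 \<Longrightarrow> uops V u i (2 * n) (w k) \<in> T"
  unfolding T_def by (rule vs.span_base) blast

lemma T_cong: "x - y \<in> T \<Longrightarrow> y \<in> T \<Longrightarrow> x \<in> T"
  using vs.subspace_add[OF subspace_T, of "x - y" y] by simp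

text \<open>A mode below \<open>-2n-1\<close> in front is rewritten by \<open>u \<circ>\<^sub>n _\<close>.\<close>
lemma reduce_high_mode:
  assumes m: "m \<ge> 2 * n + 2"
    and nonneg: "\<And>j. j \<ge> 0 \<Longrightarrow> Y u j x \<in> T"
    and lower: "\<And>l. 1 \<le> l \<Longrightarrow> l < m \<Longrightarrow> Y u (- int l) x \<in> T"
  shows "Y u (- int m) x \<in> T"
proof -
  define P where "P = nat (wt V u + int n)"
  have "R (wt V u + int n) (int m) u x \<in> T"
    using R_in_On[OF u_eigsp, of n "wt V u + int n" "int m" x] m On_subset_T by auto
  moreover have "R (wt V u + int n) (int m) u x = (\<Sum>i\<le>P. sc (of_nat (P choose i)) (Y u (int i - int m) x))"
    unfolding P_def using wt_u by (intro R_nonneg) simp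
  also have "\<dots> = Y u (- int m) x + (\<Sum>i\<in>{1..P}. sc (of_nat (P choose i)) (Y u (int i - int m) x))"
    by (simp add: sum.atLeast1_atMost_eq sum.atMost_shift)
  moreover have "(\<Sum>i\<in>{1..P}. sc (of_nat (P choose i)) (Y u (int i - int m) x)) \<in> T"
  proof (intro vs.subspace_sum vs.subspace_scale subspace_T)
    fix i assume "i \<in> {1..P}"
    thus "Y u (int i - int m) x \<in> T"
      using nonneg[of "int i - int m"] lower[of "m - i"] by (cases "i < m") (auto simp: of_nat_diff)
  qed
  ultimately show ?thesis
    using T_cong[of "Y u (- int m) x" "- (\<Sum>i\<in>{1..P}. sc (of_nat (P choose i)) (Y u (int i - int m) x))"]
    by (simp add: vs.subspace_neg[OF subspace_T])
qed

text \<open>One component for each source of simpler terms: permutation errors and nonnegative modes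
  shorten the list; the negative modes from circle products and the \<open>L(0)\<close> term lower
  the sum; the other terms of \<open>L(-1)\<close> keep both but lose a factor
  \<open>u_{-2n-1}\<close>. The index \<open>k\<close> is not measured: \<open>L(-1)\<close> raises
  it, but together with a smaller sum.\<close>

definition mode_order :: "nat list rel" where
  "mode_order = inv_image (less_than <*lex*> less_than <*lex*> less_than)
     (\<lambda>ks. (length ks, sum_list ks, count (mset ks) (2 * n + 1)))"

lemma wf_mode_order: "wf mode_order"
  unfolding mode_order_def by (intro wf_inv_image wf_lex_prod wf_less_than)

lemma umon_in_T:
  "\<forall>k\<in>set ks. k \<ge> 1 \<Longrightarrow> k \<ge> 1 \<Longrightarrow> umon V u ks (w k) \<in> T"
proof (induction ks arbitrary: k rule: wf_induct_rule[OF wf_mode_order])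
  case (1 ks)
  note pos = 1(2) and k = 1(3)
  have shorter: "umon V u ls (w k) \<in> T" if "length ls < length ks" "\<forall>k\<in>set ls. k \<ge> 1" for ls
    by (rule 1(1)) (use that k in \<open>auto simp: mode_order_def\<close>)
  have smaller: "umon V u ls (w k') \<in> T"
    if "length ls = length ks" "sum_list ls < sum_list ks" "\<forall>k\<in>set ls. k \<ge> 1" "k' \<ge> 1" for ls k'
    by (rule 1(1)) (use that in \<open>auto simp: mode_order_def\<close>)
  have fewer: "umon V u ls (w k) \<in> T"
    if "length ls = length ks" "sum_list ls = sum_list ks"
      "count (mset ls) (2 * n + 1) < count (mset ks) (2 * n + 1)" "\<forall>k\<in>set ls. k \<ge> 1" for ls
    by (rule 1(1)) (use that k in \<open>auto simp: mode_order_def\<close>)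
  have Fsp_T: "x \<in> T" if "x \<in> Fsp V u r (w k)" "r < length ks" for x r
  proof -
    have "Fsp V u r (w k) \<subseteq> T"
      by (rule Fsp_subsetI[OF subspace_T]) (use that shorter in auto)
    thus ?thesis using that by blast
  qed
  have permT: "umon V u ls (w k) - umon V u ls' (w k) \<in> T"
    if "mset ls = mset ls'" "length ls = length ks" for ls ls'
  proof (cases "ks = []")
    case True
    hence "ls = []" "ls' = []" using that by (metis length_0_conv mset_eq_length)+
    thus ?thesis by (simp add: vs.subspace_0[OF subspace_T])
  next
    case False
    thus ?thesis using Fsp_T[OF umon_perm[OF that(1), of k]] that(2) by auto
  qed
  have permT': "umon V u ks (w k) \<in> T" if "mset ks = mset ls" "umon V u ls (w k) \<in> T" for ls
    using permT[OF that(1)] that(2) T_cong by blast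
  consider (high) m where "m \<in> set ks" "m \<ge> 2 * n + 2"
    | (mid) "2 * n + 1 \<in> set ks" "\<forall>k\<in>set ks. k \<le> 2 * n + 1"
    | (low) "\<forall>k\<in>set ks. k \<le> 2 * n"
  proof (cases "\<exists>m\<in>set ks. m \<ge> 2 * n + 2")
    case False
    hence *: "\<forall>k\<in>set ks. k \<le> 2 * n + 1" by force
    show ?thesis
    proof (cases "2 * n + 1 \<in> set ks")
      case False
      hence "k \<le> 2 * n" if "k \<in> set ks" for k
        using * that by (cases "k = 2 * n + 1") (auto simp: le_Suc_eq)
      thus ?thesis using that(3) by blast
    qed (use * that(2) in blast)
  qed (use that(1) in blast)
  thus ?case
  proof cases
    case high
    define ls where "ls = remove1 m ks"
    have ls: "mset ks = mset (m # ls)" using high by (simp add: ls_def)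
    hence len: "length ks = Suc (length ls)" and sm: "sum_list ks = m + sum_list ls"
      by (metis length_Cons mset_eq_length, metis sum_list.Cons sum_mset_sum_list)
    have lpos: "\<forall>k\<in>set ls. k \<ge> 1" using pos set_remove1_subset[of m ks] by (auto simp: ls_def)
    have "Y u (- int m) (umon V u ls (w k)) \<in> T"
    proof (rule reduce_high_mode[OF high(2)])
      show "Y u j (umon V u ls (w k)) \<in> T" if "j \<ge> 0" for j
        by (rule Fsp_T[OF nonneg_mode[OF that]]) (simp add: len)
      show "Y u (- int l) (umon V u ls (w k)) \<in> T" if "1 \<le> l" "l < m" for l
        using smaller[of "l # ls" k] that lpos k by (simp add: len sm)
    qed
    thus ?thesis using permT'[OF ls] by simp
  next
    case low
    have *: "mset ks = mset (explist (count (mset ks)) (2 * n))"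
      by (rule mset_explist_count[symmetric]) (use low pos in auto)
    show ?thesis
      by (rule permT'[OF *]) (simp add: uops_in_T[OF k] flip: uops_explist)
  next
    case mid
    define ls where "ls = remove1 (2 * n + 1) ks"
    \<comment> \<open>One factor \<open>u_{-2n-1}\<close> is weakened to \<open>u_{-2n}\<close>, so
      that \<open>L(-1)\<close> restores the sum of the modes.\<close>
    define ls' where "ls' = 2 * n # ls"
    define t where "t = umon V u ks (w k)"
    have ls: "mset ks = mset ((2 * n + 1) # ls)" using mid by (simp add: ls_def)
    hence len: "length ks = Suc (length ls)" and sm: "sum_list ks = 2 * n + 1 + sum_list ls"
      by (metis length_Cons mset_eq_length, metis sum_list.Cons sum_mset_sum_list)
    have lpos: "\<forall>k\<in>set ls'. k \<ge> 1"
      using pos n_pos set_remove1_subset[of "2 * n + 1" ks] by (auto simp: ls'_def ls_def)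
    have len': "length ls' = length ks" and sm': "sum_list ls' + 1 = sum_list ks"
      by (simp_all add: len sm ls'_def)
    define g where "g = (\<lambda>p. umon V u (ls'[p := Suc (ls' ! p)]) (w k))"
    \<comment> \<open>Raising an entry 2n reproduces \<open>ks\<close> up to order, hence
      \<open>t\<close> modulo \<open>T\<close>. Raising any other entry, even 2n+1 to 2n+2, keeps
      the sum and leaves fewer entries 2n+1 than in \<open>ks\<close>.\<close>
    have g: "g p \<in> T \<or> (ls' ! p = 2 * n \<and> g p - t \<in> T)" if p: "p < length ls'" for p
    proof (cases "ls' ! p = 2 * n")
      case True
      have "mset (ls'[p := Suc (ls' ! p)]) = add_mset (2 * n + 1) (mset ls' - {#2 * n#})"
        using p by (simp add: mset_update True)
      also have "\<dots> = mset ks" by (simp add: ls'_def ls)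
      finally have "g p - t \<in> T"
        unfolding g_def t_def by (rule permT) (simp add: len')
      with True show ?thesis by blast
    next
      case False
      have ms: "mset (ls'[p := Suc (ls' ! p)]) = add_mset (Suc (ls' ! p)) (mset ls' - {#ls' ! p#})"
        using p by (simp add: mset_update)
      have "sum_list (ls'[p := Suc (ls' ! p)]) = sum_list ks"
        using p sm' by (simp add: sum_list_update)
      moreover have "count (mset (ls'[p := Suc (ls' ! p)])) (2 * n + 1) < count (mset ks) (2 * n + 1)"
        unfolding ms ls using False by (simp add: ls'_def)
      moreover have "\<forall>k\<in>set (ls'[p := Suc (ls' ! p)]). k \<ge> 1"
        using lpos set_update_subset_insert by fastforce
      ultimately have "g p \<in> T"
        unfolding g_def by (intro fewer) (simp_all add: len')
      thus ?thesis ..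
    qed
    \<comment> \<open>Each position in \<open>S\<close> contributes \<open>2n t\<close> modulo
      \<open>T\<close>. Position 0 belongs to \<open>S\<close>, so the total coefficient of
      \<open>t\<close> is nonzero.\<close>
    define S where "S = {p\<in>{..<length ls'}. g p - t \<in> T \<and> ls' ! p = 2 * n}"
    have "L (-1) (umon V u ls' (w k)) + L 0 (umon V u ls' (w k)) \<in> T"
      using OL_in_On On_subset_T by blast
    moreover have "umon V u ls' (w k) \<in> T"
      by (rule smaller) (use len' sm' lpos k in auto)
    moreover have "umon V u ls' (w k) \<in> eigsp V (wt V v + int k - 1 + (\<Sum>k\<leftarrow>ls'. wt V u + int k - 1))"
      by (rule umon_eigsp[OF u_eigsp w_eigsp])
    hence "L 0 (umon V u ls' (w k))
       = sc (of_int (wt V v + int k - 1 + (\<Sum>k\<leftarrow>ls'. wt V u + int k - 1))) (umon V u ls' (w k))"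
      unfolding eigsp_def by blast
    ultimately have "L (-1) (umon V u ls' (w k)) \<in> T"
      using vs.subspace_diff[OF subspace_T, of "L (-1) (umon V u ls' (w k)) + L 0 (umon V u ls' (w k))" "L 0 (umon V u ls' (w k))"]
      by (simp add: vs.subspace_scale[OF subspace_T])
    moreover have "umon V u ls' (L (-1) (w k)) \<in> T"
      unfolding Lm1_w umon_scl_right
      by (intro vs.subspace_scale[OF subspace_T] smaller) (use len' sm' lpos in auto)
    ultimately have "L (-1) (umon V u ls' (w k)) - umon V u ls' (L (-1) (w k)) \<in> T"
      by (rule vs.subspace_diff[OF subspace_T])
    hence "(\<Sum>p<length ls'. sc (of_nat (ls' ! p)) (g p)) \<in> T"
      unfolding Lm1_umon g_def by simp
    moreover have "(\<Sum>p<length ls'. sc (of_nat (ls' ! p)) (g p) - (if p \<in> S then sc (of_nat (2 * n)) t else 0)) \<in> T"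
    proof (rule vs.subspace_sum[OF subspace_T])
      fix p assume p: "p \<in> {..<length ls'}"
      show "sc (of_nat (ls' ! p)) (g p) - (if p \<in> S then sc (of_nat (2 * n)) t else 0) \<in> T"
      proof (cases "p \<in> S")
        case True
        hence "sc (of_nat (2 * n)) (g p - t) \<in> T" "ls' ! p = 2 * n"
          unfolding S_def using vs.subspace_scale[OF subspace_T] by auto
        thus ?thesis using True by (simp only: if_True vs.scale_right_diff_distrib)
      next
        case False
        hence "g p \<in> T" using g[of p] p by (auto simp: S_def)
        thus ?thesis using False by (simp add: vs.subspace_scale[OF subspace_T])
      qed
    qed
    ultimately have "(\<Sum>p<length ls'. sc (of_nat (ls' ! p)) (g p))
       - (\<Sum>p<length ls'. sc (of_nat (ls' ! p)) (g p) - (if p \<in> S then sc (of_nat (2 * n)) t else 0)) \<in> T"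
      by (rule vs.subspace_diff[OF subspace_T])
    hence "(\<Sum>p<length ls'. (if p \<in> S then sc (of_nat (2 * n)) t else 0)) \<in> T"
      by (simp add: sum_subtractf)
    moreover have "(\<Sum>p<length ls'. (if p \<in> S then sc (of_nat (2 * n)) t else 0)) = (\<Sum>p\<in>S. sc (of_nat (2 * n)) t)"
      by (rule sum.mono_neutral_cong_right) (auto simp: S_def)
    moreover have "\<dots> = sc (of_nat (card S * (2 * n))) t"
      by (simp flip: vs.scale_sum_left)
    ultimately have "sc (of_nat (card S * (2 * n))) t \<in> T" by simp
    hence "sc (inverse (of_nat (card S * (2 * n)))) (sc (of_nat (card S * (2 * n))) t) \<in> T"
      by (rule vs.subspace_scale[OF subspace_T])
    moreover have "card S * (2 * n) \<noteq> 0"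
    proof -
      have "g 0 - t \<in> T"
        unfolding g_def t_def by (rule permT) (simp_all add: ls'_def ls len)
      hence "0 \<in> S" by (simp add: S_def ls'_def)
      hence "card S \<noteq> 0" by (auto simp: S_def)
      thus ?thesis using n_pos by simp
    qed
    hence "(of_nat (card S * (2 * n)) :: complex) \<noteq> 0" unfolding of_nat_eq_0_iff .
    ultimately have "t \<in> T" by (simp only: vs.scale_scale left_inverse vs.scale_one not_False_eq_True)
    thus ?thesis by (simp add: t_def)
  qed
qed

lemma w_1: "w 1 = v"
  by (simp add: w_def Y_vac_right)

section \<open>The relations (2) and (3), obtained from \<open>L(-1) + L(0)\<close>\<close>

lemma approx_mode:
  "approx V (Y u (- 2 * int n - 1) (w k))
          (sc (- (of_int (wt V u + wt V v + 2 * int n + int k - 2) / (2 * of_nat n))) (Y u (- 2 * int n) (w k))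
         - sc (of_nat k / (2 * of_nat n)) (Y u (- 2 * int n) (w (Suc k))))"
proof -
  define x where "x = Y u (- 2 * int n) (w k)"
  define c where "c = (of_int (wt V u + wt V v + 2 * int n + int k - 2) :: complex)"
  define N where "N = (2 * of_nat n :: complex)"
  have N0: "N \<noteq> 0" using n_pos by (simp add: N_def)
  have "x \<in> eigsp V (wt V u + wt V v + 2 * int n + int k - 2)"
    using eigsp_Y[OF u_eigsp w_eigsp[of k], of "- 2 * int n"] by (simp add: x_def algebra_simps)
  hence L0: "L 0 x = sc c x" by (simp add: eigsp_def c_def)
  have Lm1: "L (-1) x = sc (of_nat k) (Y u (- 2 * int n) (w (Suc k))) + sc N (Y u (- 2 * int n - 1) (w k))"
    unfolding x_def Lm1_comm Lm1_w by (simp add: N_def Y_scl_right)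
  \<comment> \<open>The witness in \<open>OL V\<close> is the image of \<open>x / (2n)\<close>;
    \<open>c\<close> is the weight of \<open>x\<close>.\<close>
  have "Y u (- 2 * int n - 1) (w k) - (sc (- (c / N)) x - sc (of_nat k / N) (Y u (- 2 * int n) (w (Suc k))))
     = L (-1) (sc (1 / N) x) + L 0 (sc (1 / N) x)"
    unfolding L_scl L0 Lm1 using N0 by (simp add: vs.scale_right_distrib)
  thus ?thesis unfolding approx_def OL_def x_def c_def N_def by blast
qed

lemma sum_split_last_two:
  fixes g :: "nat \<Rightarrow> 'b::comm_monoid_add"
  shows "(\<Sum>j = 1..2 * n + 1. g j) = (\<Sum>j = 1..2 * n - 1. g j) + g (2 * n) + g (2 * n + 1)"
proof -
  have "2 * n = Suc (Suc (2 * n - 2))" using n_pos by simp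
  then obtain n' where "2 * n = Suc (Suc n')" by blast
  thus ?thesis by simp
qed

text \<open>The exponents of \<open>M\<close> trade one factor \<open>u_{-2n-1}\<close> for
  \<open>u_{-2n}\<close>. With \<open>g = 1\<close> this shows that the number of factors is
  unchanged; with the weights \<open>wt u + j - 1\<close> the sum drops by one, which is the
  \<open>- 1\<close> in the coefficient of \<open>M\<close>.\<close>

lemma sum_move_one:
  fixes g :: "nat \<Rightarrow> 'b::comm_ring_1" and i :: "nat \<Rightarrow> nat"
  assumes "i (2 * n + 1) \<ge> 1"
  shows "(\<Sum>j = 1..2 * n + 1. of_nat ((i(2 * n + 1 := i (2 * n + 1) - 1, 2 * n := i (2 * n) + 1)) j) * g j)
      = (\<Sum>j = 1..2 * n + 1. of_nat (i j) * g j) + g (2 * n) - g (2 * n + 1)"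
proof -
  have "(\<Sum>j = 1..2 * n - 1. of_nat ((i(2 * n + 1 := i (2 * n + 1) - 1, 2 * n := i (2 * n) + 1)) j) * g j)
      = (\<Sum>j = 1..2 * n - 1. of_nat (i j) * g j)"
    using n_pos by (intro sum.cong) auto
  thus ?thesis unfolding sum_split_last_two using assms by (simp add: of_nat_diff algebra_simps)
qed

text \<open>The space \<open>E\<close> of reordering errors is left open: it will be
  \<open>F_{N-1}(v_{-k} 1)\<close> in general and zero when the modes commute, so that one
  computation yields both claims about \<open>f\<close>.\<close>

lemma monomial_relation:
  fixes i :: "nat \<Rightarrow> nat"
  assumes i: "i (2 * n + 1) \<ge> 1"
  defines "N \<equiv> (\<Sum>j = 1..2 * n + 1. i j)"
    and "I1 \<equiv> i(2 * n + 1 := i (2 * n + 1) - 1, 2 * n := i (2 * n) + 1)"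
    and "I2 \<equiv> i(2 * n + 1 := i (2 * n + 1) - 2, 2 * n := i (2 * n) + 1)"
  defines "M \<equiv> (\<lambda>w. uops V u I1 (2 * n + 1) w)"
    and "Ml \<equiv> (\<lambda>l w. uops V u (I1(l + 1 := I1 (l + 1) + 1, l := I1 l - 1)) (2 * n + 1) w)"
    and "D \<equiv> (\<lambda>w. \<Sum>j = 1..nat (int n + wt V u).
                     sc (of_nat (nat (int n + wt V u) choose (j - 1)))
                       (Y u (wt V u - int n - int j - 1) w))"
  assumes E: "vs.subspace E"
    and permE: "\<And>ks ls. mset ks = mset ls \<Longrightarrow> length ks = N \<Longrightarrow> \<forall>k\<in>set ks. k \<ge> 1 \<Longrightarrow>
                  umon V u ks (w k) - umon V u ls (w k) \<in> E"
  shows "\<exists>f\<in>E. equivn V n (uops V u i (2 * n + 1) (w k))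
                  (sc (- 1 / (2 * of_nat n * (of_nat (i (2 * n)) + 1)))
                    (sc (of_int (wt V (w k)) - 1
                             + (\<Sum>j = 1..2 * n + 1. of_nat (i j) * of_int (wt V u + int j - 1)))
                        (M (w k))
                     - sc ((2 * of_nat n + 1) * (of_nat (i (2 * n + 1)) - 1))
                         (D (uops V u I2 (2 * n + 1) (w k)))
                     + (\<Sum>l = 1..2 * n - 1. sc (of_nat l * of_nat (i l)) (Ml l (w k)))
                     + sc (of_nat k) (M (w (Suc k)))
                     + f))"
proof -
  have I1: "I1 l = i l" if "l \<in> {1..2 * n - 1}" for l
    using that n_pos by (auto simp: I1_def)
  have I1': "I1 (2 * n) = i (2 * n) + 1" "I1 (2 * n + 1) = i (2 * n + 1) - 1"
    by (simp_all add: I1_def)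
  note sum_I1 = sum_move_one[where i = i, OF i, folded I1_def]
  define K where "K = explist I1 (2 * n + 1)"
  define m0 where "m0 = wt V (w k)"
  have w0: "w k \<in> eigsp V m0"
    unfolding m0_def by (rule eigsp_wt[OF eigsp_homI[OF w_eigsp]])
  have Kpos: "\<forall>l\<in>set K. l \<ge> 1"
    by (auto simp: K_def dest: explist_pos)
  have lenK: "length K = N"
  proof -
    have "int (length K) = int N"
      using sum_I1[where g = "\<lambda>_. 1 :: int"] by (simp add: K_def length_explist N_def)
    thus ?thesis by simp
  qed
  \<comment> \<open>The sorted form of what \<open>L(-1)\<close> makes of \<open>M\<close> by
    raising a factor \<open>u_{-l}\<close>: \<open>M^(l)\<close> for \<open>l < 2n\<close>, the
    original monomial for \<open>l = 2n\<close>, and \<open>u_{-2n-2}\<close> in front for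
    \<open>l = 2n+1\<close>. The truncated subtraction in \<open>I2\<close> is harmless: if the
    exponent is 1, then \<open>M\<close> has no factor \<open>u_{-2n-1}\<close> and the coefficient
    is zero.\<close>
  define tl where "tl = (\<lambda>l. if l \<le> 2 * n then explist (I1(l + 1 := I1 (l + 1) + 1, l := I1 l - 1)) (2 * n + 1)
       else (2 * n + 2) # explist I2 (2 * n + 1))"
  have mset_tl: "mset (tl l) = add_mset (Suc l) (mset K - {#l#})" if l: "l \<in> set K" for l
  proof -
    have "count (mset K) l > 0" using l by simp
    hence l': "1 \<le> l" "l \<le> 2 * n + 1" "I1 l > 0"
      unfolding K_def count_explist by (auto split: if_splits)
    show ?thesis
    proof (cases "l \<le> 2 * n")
      case True
      show ?thesis
        by (rule multiset_eqI) (use True l' in \<open>auto simp: tl_def K_def count_explist\<close>)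
    next
      case False
      hence [simp]: "l = Suc (2 * n)" using l' by simp
      show ?thesis
        by (rule multiset_eqI) (use l' n_pos in \<open>auto simp: tl_def K_def count_explist I1_def I2_def\<close>)
    qed
  qed
  \<comment> \<open>The total reordering error, which becomes \<open>f\<close>.\<close>
  define e where "e = (\<Sum>p<length K. sc (of_nat (K ! p))
      (umon V u (K[p := Suc (K ! p)]) (w k) - umon V u (tl (K ! p)) (w k)))"
  have eE: "e \<in> E"
    unfolding e_def
  proof (intro vs.subspace_sum[OF E] vs.subspace_scale[OF E] permE)
    fix p assume p: "p \<in> {..<length K}"
    show "mset (K[p := Suc (K ! p)]) = mset (tl (K ! p))"
      using p by (simp add: mset_tl mset_update)
    show "length (K[p := Suc (K ! p)]) = N" by (simp add: lenK)
    show "\<forall>k\<in>set (K[p := Suc (K ! p)]). k \<ge> 1"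
      using Kpos set_update_subset_insert[of K p "Suc (K ! p)"] by auto
  qed
  define c where "c = (2 * of_nat n * (of_nat (i (2 * n)) + 1) :: complex)"
  define d where "d = ((2 * of_nat n + 1) * (of_nat (i (2 * n + 1)) - 1) :: complex)"
  define X where "X = uops V u I2 (2 * n + 1) (w k)"
  define y where "y = uops V u i (2 * n + 1) (w k)"
  define S where "S = (\<Sum>l = 1..2 * n - 1. sc (of_nat l * of_nat (i l)) (Ml l (w k)))"
  have c0: "c \<noteq> 0"
  proof -
    have "c = of_nat (2 * n * (i (2 * n) + 1))" by (simp add: c_def algebra_simps)
    also have "\<dots> \<noteq> 0" unfolding of_nat_eq_0_iff using n_pos by simp
    finally show ?thesis .
  qed
  have "(\<Sum>p<length K. sc (of_nat (K ! p)) (umon V u (tl (K ! p)) (w k)))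
     = (\<Sum>l = 1..2 * n + 1. sc (of_nat (I1 l)) (sc (of_nat l) (umon V u (tl l) (w k))))"
    unfolding K_def by (rule sum_nth_explist)
  also have "\<dots> = (\<Sum>l = 1..2 * n - 1. sc (of_nat (I1 l)) (sc (of_nat l) (umon V u (tl l) (w k))))
     + sc (of_nat (I1 (2 * n))) (sc (of_nat (2 * n)) (umon V u (tl (2 * n)) (w k)))
     + sc (of_nat (I1 (2 * n + 1))) (sc (of_nat (2 * n + 1)) (umon V u (tl (2 * n + 1)) (w k)))"
    by (rule sum_split_last_two)
  also have "(\<Sum>l = 1..2 * n - 1. sc (of_nat (I1 l)) (sc (of_nat l) (umon V u (tl l) (w k)))) = S"
    unfolding S_def by (rule sum.cong) (auto simp: I1 tl_def Ml_def uops_explist mult.commute simp del: uops.simps explist.simps)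
  also have "sc (of_nat (I1 (2 * n))) (sc (of_nat (2 * n)) (umon V u (tl (2 * n)) (w k))) = sc c y"
  proof -
    have "I1(2 * n + 1 := I1 (2 * n + 1) + 1, 2 * n := I1 (2 * n) - 1) = i"
      using i by (auto simp: I1_def fun_eq_iff)
    hence "umon V u (tl (2 * n)) (w k) = y"
      by (simp add: tl_def y_def uops_explist del: fun_upd_apply uops.simps explist.simps)
    thus ?thesis unfolding I1' by (simp add: c_def mult.commute)
  qed
  also have "sc (of_nat (I1 (2 * n + 1))) (sc (of_nat (2 * n + 1)) (umon V u (tl (2 * n + 1)) (w k)))
     = sc d (Y u (- int (2 * n + 2)) X)"
    unfolding I1' using i by (simp add: tl_def X_def uops_explist d_def of_nat_diff mult.commute del: uops.simps explist.simps)
  finally have main: "L (-1) (M (w k)) = S + sc c y + sc d (Y u (- int (2 * n + 2)) X)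
      + sc (of_nat k) (M (w (Suc k))) + e"
    unfolding M_def uops_explist Lm1_umon Lm1_w umon_scl_right
    by (simp add: e_def vs.scale_right_diff_distrib sum_subtractf K_def)
  define a where "a = (of_int m0 - 1 + (\<Sum>j = 1..2 * n + 1. of_nat (i j) * of_int (wt V u + int j - 1)) :: complex)"
  have L0: "L 0 (M (w k)) = sc a (M (w k))"
  proof -
    have "M (w k) \<in> eigsp V (m0 + (\<Sum>l\<leftarrow>K. wt V u + int l - 1))"
      unfolding M_def uops_explist K_def by (rule umon_eigsp[OF u_eigsp w0])
    moreover have "(\<Sum>l\<leftarrow>K. wt V u + int l - 1) = (\<Sum>j = 1..2 * n + 1. int (i j) * (wt V u + int j - 1)) - 1"
      unfolding K_def sum_list_explist of_nat_id sum_I1 by simp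
    ultimately show ?thesis by (simp add: eigsp_def a_def)
  qed
  define r where "r = R (wt V u + int n) (int (2 * n + 2)) u X"
  have r: "r \<in> On V n"
    unfolding r_def by (rule R_in_On[OF u_eigsp]) auto
  have rD: "r = Y u (- int (2 * n + 2)) X + D X"
  proof -
    define P where "P = nat (int n + wt V u)"
    have P: "int P = wt V u + int n" using wt_u by (simp add: P_def)
    have "r = (\<Sum>j\<le>P. sc (of_nat (P choose j)) (Y u (int j - int (2 * n + 2)) X))"
      unfolding r_def P_def using wt_u by (subst R_nonneg) (simp_all add: add.commute)
    also have "\<dots> = Y u (- int (2 * n + 2)) X + (\<Sum>j = 1..P. sc (of_nat (P choose j)) (Y u (int j - int (2 * n + 2)) X))"
      by (simp add: sum.atLeast1_atMost_eq sum.atMost_shift)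
    also have "(\<Sum>j = 1..P. sc (of_nat (P choose j)) (Y u (int j - int (2 * n + 2)) X)) = D X"
      unfolding D_def P_def[symmetric]
    \<comment> \<open>\<open>D\<close> runs through the modes of the residue in reverse order; the
      symmetry of the binomial coefficients matches the two sums.\<close>
    proof (rule sum.reindex_bij_witness[of _ "\<lambda>j. P + 1 - j" "\<lambda>j. P + 1 - j"])
      fix j assume j: "j \<in> {1..P}"
      have "P choose j = P choose (P + 1 - j - 1)"
        using j binomial_symmetric[of j P] by simp
      moreover have "int j - int (2 * n + 2) = wt V u - int n - int (P + 1 - j) - 1"
        using j P by (simp add: of_nat_diff)
      ultimately show "sc (of_nat (P choose (P + 1 - j - 1))) (Y u (wt V u - int n - int (P + 1 - j) - 1) X)
          = sc (of_nat (P choose j)) (Y u (int j - int (2 * n + 2)) X)" by (simp only:)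
    qed auto
    finally show ?thesis .
  qed
  have "y - sc (- 1 / c) (sc a (M (w k)) - sc d (D X) + S + sc (of_nat k) (M (w (Suc k))) + e)
     = sc (1 / c) (L (-1) (M (w k)) + L 0 (M (w k)) - sc d r)"
    unfolding main L0 rD using c0 by (simp add: vs.scale_right_distrib vs.scale_right_diff_distrib)
  also have "\<dots> \<in> On V n"
    by (intro vs.subspace_scale vs.subspace_diff subspace_On OL_in_On r)
  finally have "equivn V n y (sc (- 1 / c) (sc a (M (w k)) - sc d (D X) + S + sc (of_nat k) (M (w (Suc k))) + e))"
    unfolding equivn_def .
  thus ?thesis
    using eE unfolding y_def c_def a_def d_def X_def S_def m0_def by blast
qed

end

section \<open>The subalgebra \<open>A_n^u\<close>\<close>

context voa_perm
begin

text \<open>The elements even span modulo \<open>O_n(V)\<close>, which is stronger than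
  generating.\<close>

lemma Anu_eq: "Anu V n u = spn V ({uops V u i (2 * n) vc | i. True} \<union> On V n)"
proof -
  \<comment> \<open>All nonnegative modes annihilate the vacuum, so it may play the role of
    \<open>v\<close>.\<close>
  interpret vac: voa_perm_vec V n u vc
    by unfold_locales (auto simp: Y_vac_right intro: eigsp_homI[OF vac_eigsp])
  define S where "S = vs.span ({uops V u i (2 * n) vc | i. True} \<union> On V n)"
  have subS: "vs.subspace S" by (simp add: S_def)
  have OnS: "On V n \<subseteq> S" unfolding S_def using vs.span_superset by blast
  have uops_Vu: "uops V u i (2 * n) vc \<in> Vu V u" for i
    unfolding uops_explist by (rule umon_in_Vu) (auto dest: explist_pos)
  have TS: "vac.T \<subseteq> S"
    unfolding vac.T_def
  proof (rule vs.span_minimal[OF _ subS], safe)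
    fix i k
    have "uops V u i (2 * n) (vac.w k) = (if k = 1 then uops V u i (2 * n) vc else 0)"
      by (simp add: vac.w_def Y_vac_left uops_explist)
    moreover have "uops V u i (2 * n) vc \<in> S"
      unfolding S_def by (rule vs.span_base) blast
    ultimately show "uops V u i (2 * n) (vac.w k) \<in> S"
      by (simp add: vs.subspace_0[OF subS])
  qed (use OnS in blast)
  have VuS: "Vu V u \<subseteq> S"
  proof (rule Vu_subsetI[OF subS])
    fix ks :: "nat list" assume "\<forall>k\<in>set ks. k \<ge> 1"
    hence "umon V u ks (vac.w 1) \<in> vac.T" by (rule vac.umon_in_T) simp
    thus "umon V u ks vc \<in> S" using TS unfolding vac.w_1 by blast
  qed
  have S_sum: "\<exists>x y. a = x + y \<and> x \<in> Vu V u \<and> y \<in> On V n" if "a \<in> S" for a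
  proof -
    have "S \<subseteq> vs.span (Vu V u \<union> On V n)"
      unfolding S_def by (rule vs.span_mono) (use uops_Vu in blast)
    hence "a \<in> {x + y |x y. x \<in> Vu V u \<and> y \<in> On V n}"
      using that unfolding vs.span_Un vs.span_eq_iff[THEN iffD2, OF subspace_Vu]
        vs.span_eq_iff[THEN iffD2, OF subspace_On] by blast
    thus ?thesis by blast
  qed
  \<comment> \<open>The ideal property disposes of every product except that of the two parts in
    \<open>Vu V u\<close>.\<close>
  have starS: "star V n a b \<in> S" if ab: "a \<in> S" "b \<in> S" for a b
  proof -
    obtain a1 a2 b1 b2 where *: "a = a1 + a2" "a1 \<in> Vu V u" "a2 \<in> On V n"
        "b = b1 + b2" "b1 \<in> Vu V u" "b2 \<in> On V n"
      using S_sum[OF ab(1)] S_sum[OF ab(2)] by blast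
    have "star V n a b = star V n a1 b1 + (star V n a1 b2 + star V n a2 b)"
      by (simp add: * star_add_left star_add_right algebra_simps)
    moreover have "star V n a1 b1 \<in> S" using star_Vu * VuS by blast
    moreover have "star V n a1 b2 \<in> S" "star V n a2 b \<in> S"
      using star_On_left star_On_right * OnS by blast+
    ultimately show ?thesis by (simp add: vs.subspace_add[OF subS])
  qed
  have "Anu V n u \<subseteq> S"
    unfolding Anu_def by (rule Inter_lower) (use subS VuS OnS starS in auto)
  moreover have "S \<subseteq> Anu V n u"
    unfolding Anu_def
  proof (rule Inter_greatest)
    fix X assume X: "X \<in> {S. vs.subspace S \<and> Vu V u \<subseteq> S \<and> On V n \<subseteq> S \<and> (\<forall>a\<in>S. \<forall>b\<in>S. star V n a b \<in> S)}"
    show "S \<subseteq> X"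
      unfolding S_def by (rule vs.span_minimal) (use X uops_Vu in blast)+
  qed
  ultimately show ?thesis by (simp add: S_def)
qed

end

theorem theorem3p8:
  fixes V :: "'v::ab_group_add voa" and n :: nat and u :: 'v and W :: "'v set"
  assumes VOA: "is_VOA V"
    and n_pos: "n \<ge> 1"
    and u_hom: "hom V u"
    and wt_u: "wt V u \<ge> - int n"
    and sub: "vertex_subalg V (Vu V u)"
    and perm: "perm_prop V u (Vu V u)"
    and strong: "acts_strongly V u W"
    and W_hom: "\<forall>w\<in>W. hom V w"
  shows
    "Anu V n u = spn V ({uops V u i (2 * n) (vac V) | i. True} \<union> On V n)
   \<and> (\<forall>ks v. v \<in> W \<and> (\<forall>k\<in>set ks. k \<ge> 1) \<longrightarrow>
        umon V u ks v \<in> spn V ({uops V u i (2 * n) (md V v' (- int k) (vac V)) | i v' k.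
                                   v' \<in> W \<and> k \<ge> 1} \<union> On V n))
   \<and> (\<forall>v\<in>W. \<forall>k::nat. k \<ge> 1 \<longrightarrow>
        approx V (md V u (- 2 * int n - 1) (md V v (- int k) (vac V)))
          (scl V (- (of_int (wt V u + wt V v + 2 * int n + int k - 2) / (2 * of_nat n)))
              (md V u (- 2 * int n) (md V v (- int k) (vac V)))
         - scl V (of_nat k / (2 * of_nat n))
              (md V u (- 2 * int n) (md V v (- int k - 1) (vac V)))))
   \<and> (\<forall>v\<in>W. \<forall>k::nat. \<forall>i::nat \<Rightarrow> nat. k \<ge> 1 \<and> i (2 * n + 1) \<ge> 1 \<longrightarrow>
        (let w0 = md V v (- int k) (vac V);
             w1 = md V v (- int k - 1) (vac V);
             N = (\<Sum>j = 1..2 * n + 1. i j);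
             I1 = i(2 * n + 1 := i (2 * n + 1) - 1, 2 * n := i (2 * n) + 1);
             I2 = i(2 * n + 1 := i (2 * n + 1) - 2, 2 * n := i (2 * n) + 1);
             M = (\<lambda>w. uops V u I1 (2 * n + 1) w);
             Ml = (\<lambda>l w. uops V u (I1(l + 1 := I1 (l + 1) + 1, l := I1 l - 1)) (2 * n + 1) w);
             D = (\<lambda>w. \<Sum>j = 1..nat (int n + wt V u).
                     scl V (of_nat (nat (int n + wt V u) choose (j - 1)))
                       (md V u (wt V u - int n - int j - 1) w))
         in \<exists>f. f \<in> Fsp V u (N - 1) w0
              \<and> ((\<forall>j1 j2 w. j1 \<ge> 1 \<and> j2 \<ge> 1 \<longrightarrow>
                     md V u (- j1) (md V u (- j2) w) = md V u (- j2) (md V u (- j1) w))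
                   \<longrightarrow> f = 0)
              \<and> equivn V n (uops V u i (2 * n + 1) w0)
                  (scl V (- 1 / (2 * of_nat n * (of_nat (i (2 * n)) + 1)))
                    (scl V (of_int (wt V w0) - 1
                             + (\<Sum>j = 1..2 * n + 1. of_nat (i j) * of_int (wt V u + int j - 1)))
                        (M w0)
                     - scl V ((2 * of_nat n + 1) * (of_nat (i (2 * n + 1)) - 1))
                         (D (uops V u I2 (2 * n + 1) w0))
                     + (\<Sum>l = 1..2 * n - 1. scl V (of_nat l * of_nat (i l)) (Ml l w0))
                     + scl V (of_nat k) (M w1)
                     + f))))"
proof -
  interpret voa_perm V n u
    using assms by unfold_locales auto
  have vec: "voa_perm_vec V n u v" if v: "v \<in> W" for v
  proof unfold_locales
    show "hom V v" using W_hom v by blast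
    show "md V u j v = 0" if "j \<ge> 0" for j
      using strong u_in_Vu v that by (auto simp: acts_strongly_def)
  qed
  have w_def: "voa_perm_vec.w V v = (\<lambda>k. md V v (- int k) (vac V))" if "v \<in> W" for v
    using voa_perm_vec.w_def[OF vec[OF that]] by blast
  have Suc_eq: "- int (Suc k) = - int k - 1" for k by simp
  show ?thesis
  proof (intro conjI allI impI ballI)
    show "Anu V n u = spn V ({uops V u i (2 * n) (vac V) | i. True} \<union> On V n)"
      by (rule Anu_eq)
  next
    fix ks :: "nat list" and v assume *: "v \<in> W \<and> (\<forall>k\<in>set ks. k \<ge> 1)"
    interpret voa_perm_vec V n u v using * vec by blast
    \<comment> \<open>\<open>v = v_{-1} 1\<close>, so this is the case \<open>k = 1\<close>.\<close>
    have "umon V u ks (w 1) \<in> T" by (rule umon_in_T) (use * in auto)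
    hence "umon V u ks v \<in> T" unfolding w_1 .
    moreover have "T \<subseteq> spn V ({uops V u i (2 * n) (md V v' (- int k) (vac V)) | i v' k.
                                   v' \<in> W \<and> k \<ge> 1} \<union> On V n)"
      unfolding T_def spn_eq w_def by (rule vs.span_mono) (use * in blast)
    ultimately show "umon V u ks v \<in> spn V ({uops V u i (2 * n) (md V v' (- int k) (vac V)) | i v' k.
                                   v' \<in> W \<and> k \<ge> 1} \<union> On V n)" by blast
  next
    fix v k assume v: "v \<in> W" and "(k::nat) \<ge> 1"
    interpret voa_perm_vec V n u v using v vec by blast
    show "approx V (md V u (- 2 * int n - 1) (md V v (- int k) (vac V)))
          (scl V (- (of_int (wt V u + wt V v + 2 * int n + int k - 2) / (2 * of_nat n)))
              (md V u (- 2 * int n) (md V v (- int k) (vac V)))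
         - scl V (of_nat k / (2 * of_nat n))
              (md V u (- 2 * int n) (md V v (- int k - 1) (vac V))))"
      using approx_mode[of k] unfolding w_def Suc_eq .
  next
    fix v k and i :: "nat \<Rightarrow> nat"
    assume v: "v \<in> W" and ki: "(k::nat) \<ge> 1 \<and> i (2 * n + 1) \<ge> 1"
    interpret voa_perm_vec V n u v using v vec by blast
    define C where "C \<longleftrightarrow> (\<forall>j1 j2 w. j1 \<ge> 1 \<and> j2 \<ge> 1 \<longrightarrow>
                     md V u (- j1) (md V u (- j2) w) = md V u (- j2) (md V u (- j1) w))"
    define N where "N = (\<Sum>j = 1..2 * n + 1. i j)"
    \<comment> \<open>Choosing the zero space in the commuting case is what forces
      \<open>f = 0\<close> there.\<close>
    define E where "E = (if C then {0} else Fsp V u (N - 1) (w k))"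
    have E: "vs.subspace E" by (simp add: E_def subspace_Fsp)
    have permE: "umon V u ks (w k) - umon V u ls (w k) \<in> E"
      if "mset ks = mset ls" "length ks = N" "\<forall>k\<in>set ks. k \<ge> 1" for ks ls
    proof (cases C)
      case True
      have "umon V u ks (w k) = umon V u ls (w k)"
        by (rule umon_perm_commuting[OF _ that(1,3)]) (use True in \<open>simp add: C_def\<close>)
      thus ?thesis using True by (simp add: E_def)
    next
      case False
      thus ?thesis using umon_perm[OF that(1), of k] that(2) by (simp add: E_def)
    qed
    have E_Fsp: "f \<in> Fsp V u (N - 1) (w k) \<and> (C \<longrightarrow> f = 0)" if "f \<in> E" for f
      using that by (auto simp: E_def vs.subspace_0[OF subspace_Fsp] split: if_splits)
    note rel = monomial_relation[of i E k, OF conjunct2[OF ki] E permE[unfolded N_def]]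
    show "let w0 = md V v (- int k) (vac V);
             w1 = md V v (- int k - 1) (vac V);
             N = (\<Sum>j = 1..2 * n + 1. i j);
             I1 = i(2 * n + 1 := i (2 * n + 1) - 1, 2 * n := i (2 * n) + 1);
             I2 = i(2 * n + 1 := i (2 * n + 1) - 2, 2 * n := i (2 * n) + 1);
             M = (\<lambda>w. uops V u I1 (2 * n + 1) w);
             Ml = (\<lambda>l w. uops V u (I1(l + 1 := I1 (l + 1) + 1, l := I1 l - 1)) (2 * n + 1) w);
             D = (\<lambda>w. \<Sum>j = 1..nat (int n + wt V u).
                     scl V (of_nat (nat (int n + wt V u) choose (j - 1)))
                       (md V u (wt V u - int n - int j - 1) w))
         in \<exists>f. f \<in> Fsp V u (N - 1) w0
              \<and> ((\<forall>j1 j2 w. j1 \<ge> 1 \<and> j2 \<ge> 1 \<longrightarrow>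
                     md V u (- j1) (md V u (- j2) w) = md V u (- j2) (md V u (- j1) w))
                   \<longrightarrow> f = 0)
              \<and> equivn V n (uops V u i (2 * n + 1) w0)
                  (scl V (- 1 / (2 * of_nat n * (of_nat (i (2 * n)) + 1)))
                    (scl V (of_int (wt V w0) - 1
                             + (\<Sum>j = 1..2 * n + 1. of_nat (i j) * of_int (wt V u + int j - 1)))
                        (M w0)
                     - scl V ((2 * of_nat n + 1) * (of_nat (i (2 * n + 1)) - 1))
                         (D (uops V u I2 (2 * n + 1) w0))
                     + (\<Sum>l = 1..2 * n - 1. scl V (of_nat l * of_nat (i l)) (Ml l w0))
                     + scl V (of_nat k) (M w1)
                     + f))"
      unfolding Let_def
      using rel E_Fsp unfolding C_def N_def w_def Suc_eq by blast
  qed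
qed

end
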